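(* Let $k \geq 1$ be an integer and let $\mathsf{V} = \mathbb{C}x \oplus \mathbb{C}y$ be the natural two-dimensional module of the Lie superalgebra $\mathfrak{gl}(1|1)$ over $\mathbb{C}$. Let the planar rook algebra $\mathbb{C}\mathsf{P}_{k-1}$ act on $\mathsf{V}^{\otimes k}$ by the linear extension of $$d\, v_{\mathsf{s}} = v_{d\mathsf{s}}, \qquad d\,(f v_{\mathsf{s}}) = f v_{d\mathsf{s}} \qquad (d \in \mathsf{P}_{k-1},\ \mathsf{s} \subseteq \{1,\dots,k-1\}),$$ where $v_{d\mathsf{s}}$ is interpreted as $0$ if $\mathsf{s} \not\subseteq \beta(d)$. Then $$\mathsf{End}_{\mathfrak{gl}(1|1)}(\mathsf{V}^{\otimes k}) = \mathbb{C}\mathsf{P}_{k-1},$$ that is, the algebra homomorphism $\mathbb{C}\mathsf{P}_{k-1} \to \mathsf{End}_{\mathbb{C}}(\mathsf{V}^{\otimes k})$ given by this action is injective and its image is exactly $\mathsf{End}_{\mathfrak{gl}(1|1)}(\mathsf{V}^{\otimes k})$, the algebra of linear endomorphisms of $\mathsf{V}^{\otimes k}$ commuting with the action of $\mathfrak{gl}(1|1)$.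
   Context: The Lie superalgebra $\mathfrak{gl}(1|1) = \mathfrak{g}_0 \oplus \mathfrak{g}_1$ over $\mathbb{C}$ consists of all $2\times 2$ complex matrices with bracket $[a,b] = ab - (-1)^{\alpha\beta}ba$ for $a \in \mathfrak{g}_\alpha$, $b \in \mathfrak{g}_\beta$, $\alpha,\beta \in \mathbb{Z}/2\mathbb{Z}$. It has basis $e = \begin{pmatrix}0&1\\0&0\end{pmatrix}$, $f = \begin{pmatrix}0&0\\1&0\end{pmatrix}$, $h_1 = \begin{pmatrix}1&0\\0&0\end{pmatrix}$, $h_2 = \begin{pmatrix}0&0\\0&1\end{pmatrix}$, with $\mathfrak{g}_0 = \mathbb{C}h_1 \oplus \mathbb{C}h_2$ and $\mathfrak{g}_1 = \mathbb{C}e \oplus \mathbb{C}f$. The natural module is $\mathsf{V} = \mathsf{V}_0 \oplus \mathsf{V}_1$ with $\mathsf{V}_0 = \mathbb{C}x$, $\mathsf{V}_1 = \mathbb{C}y$, identified with $2\times 1$ column matrices with $x = (1,0)^T$, $y = (0,1)^T$, and action by matrix multiplication: $ex = 0$, $ey = x$, $fx = y$, $fy = 0$, $h_1x = x$, $h_1y = 0$, $h_2x = 0$, $h_2y = y$. The action on tensor products is $a(v \otimes w) = av \otimes w + (-1)^{\alpha\beta} v \otimes aw$ for $a \in \mathfrak{g}_\alpha$ and $v$ homogeneous of degree $\beta$; iterating this gives the action on $\mathsf{V}^{\otimes k}$. For $\mathsf{s} \subseteq \{1,\dots,k-1\}$ set $u_{\mathsf{s}} = u_1 \otimes \cdots \otimes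 u_{k-1}$ with $u_i = x$ if $i \in \mathsf{s}$ and $u_i = y$ if $i \notin \mathsf{s}$, and $v_{\mathsf{s}} = e(y \otimes u_{\mathsf{s}}) = x \otimes u_{\mathsf{s}} - y \otimes e u_{\mathsf{s}} \in \mathsf{V}^{\otimes k}$ (for $k=1$, $v_\emptyset = ey = x$). The vectors $v_{\mathsf{s}}, f v_{\mathsf{s}}$, with $\mathsf{s}$ ranging over all subsets of $\{1,\dots,k-1\}$, form a basis of $\mathsf{V}^{\otimes k}$. The planar rook monoid $\mathsf{P}_n$ consists of the diagrams with two rows of $n$ vertices (each row labeled $1,\dots,n$ from left to right) in which each vertex is incident to at most one edge, each edge joins a bottom vertex to a top vertex, and no two edges cross. Equivalently, $\mathsf{P}_n$ is the monoid of all order-preserving partial permutations of $\{1,\dots,n\}$: a diagram $d$ is an order-preserving bijection $d: \beta(d) \to \tau(d)$, where $\beta(d)$ (resp. $\tau(d)$) is the set of bottom-row (resp. top-row) vertices with an edge. The product $d_1d_2$ is concatenation of diagrams with $d_1$ placed above $d_2$ (keeping the edges that connect through), i.e. composition of partial maps with $d_2$ applied first. The planar rook algebra $\mathbb{C}\mathsf{P}_n$ is the monoid algebra of $\mathsf{P}_n$ over $\mathbb{C}$: it has basis $\mathsf{P}_n$ and multiplication extended linearly; $\mathbb{C}\mathsf{P}_0 = \mathbb{C}$. For $\mathsf{s} \subseteq \beta(d)$, $d\mathsf{s}$ denotes the image of $\mathsf{s}$ under $d$. *)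

theory Defs
  imports "HOL-Analysis.Analysis" "HOL-Algebra.Module" "HOL-Library.Function_Algebras"
begin

section \<open>The natural module and its tensor powers\<close>

text \<open>The elements \<open>1, 2\<close> of the numeral type \<open>2\<close> index the basis vectors \<open>x = (1,0)\<^sup>T\<close> and
  \<open>y = (0,1)\<^sup>T\<close> of \<open>V = \<complex>\<^sup>2\<close>.  A tensor is given by its coordinates with respect to the words in
  \<open>x, y\<close>, and \<open>V\<close> to the tensor power \<open>k\<close> consists of the coordinate functions supported on
  words of length \<open>k\<close>.\<close>

type_synonym tensor = "2 list \<Rightarrow> complex"

definition xvec :: "complex^2" where "xvec = axis 1 1"

definition yvec :: "complex^2" where "yvec = axis 2 1"

definition tensor_power :: "nat \<Rightarrow> tensor set" where
  "tensor_power k = {t. \<forall>w. length w \<noteq> k \<longrightarrow> t w = 0}"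

definition tscale :: "complex \<Rightarrow> tensor \<Rightarrow> tensor" where
  "tscale c t = (\<lambda>w. c * t w)"

text \<open>The tensor product of a vector \<open>v\<close> in \<open>V\<close> with a tensor \<open>t\<close>.\<close>

definition tprod :: "complex^2 \<Rightarrow> tensor \<Rightarrow> tensor" where
  "tprod v t = (\<lambda>w. case w of [] \<Rightarrow> 0 | i # u \<Rightarrow> v $ i * t u)"

primrec pure_tensor :: "(complex^2) list \<Rightarrow> tensor" where
  "pure_tensor [] = (\<lambda>w. if w = [] then 1 else 0)"
| "pure_tensor (v # vs) = tprod v (pure_tensor vs)"


section \<open>The Lie superalgebra \<open>gl(1|1)\<close> and its action\<close>

type_synonym gl11 = "complex^2^2"

definition e_mat :: gl11 where "e_mat = vector [vector [0, 1], vector [0, 0]]"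

definition f_mat :: gl11 where "f_mat = vector [vector [0, 0], vector [1, 0]]"

definition deg :: "2 \<Rightarrow> nat" where
  "deg i = (if i = 1 then 0 else 1)"

text \<open>The component of degree \<open>\<alpha> \<in> {0, 1}\<close>: the diagonal part for \<open>\<alpha> = 0\<close>, the off-diagonal part
  for \<open>\<alpha> = 1\<close>.\<close>

definition component :: "nat \<Rightarrow> gl11 \<Rightarrow> gl11" where
  "component \<alpha> a = (\<chi> i j. if (deg i + deg j) mod 2 = \<alpha> then a $ i $ j else 0)"

text \<open>The bracket of \<open>gl(1|1)\<close>, recorded for completeness: commuting with the action does not
  involve it.\<close>

definition gl_bracket :: "gl11 \<Rightarrow> gl11 \<Rightarrow> gl11" where
  "gl_bracket a b = (\<Sum>\<alpha>\<in>{0, 1}. \<Sum>\<beta>\<in>{0, 1}.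
     component \<alpha> a ** component \<beta> b - (- 1) ^ (\<alpha> * \<beta>) *\<^sub>R (component \<beta> b ** component \<alpha> a))"

text \<open>The action of a homogeneous \<open>a\<close> of degree \<open>\<alpha>\<close> on the tensor power \<open>k\<close>, obtained by iterating
  \<open>a(v \<otimes> w) = av \<otimes> w + (-1)\<^bsup>\<alpha>\<beta>\<^esup> v \<otimes> aw\<close> with \<open>v\<close> in \<open>V\<close> of degree \<open>\<beta>\<close>; it is applied to the
  decomposition \<open>t = \<Sum>i. v\<^sub>i \<otimes> t\<^sub>i\<close> where \<open>v\<^sub>1 = x\<close>, \<open>v\<^sub>2 = y\<close> and \<open>t\<^sub>i u = t (i # u)\<close>.\<close>

primrec hom_act :: "nat \<Rightarrow> gl11 \<Rightarrow> nat \<Rightarrow> tensor \<Rightarrow> tensor" where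
  "hom_act \<alpha> a 0 t = 0"
| "hom_act \<alpha> a (Suc k) t =
     (\<Sum>i\<in>UNIV. tprod (a *v axis i 1) (\<lambda>u. t (i # u)) +
        tscale ((- 1) ^ (\<alpha> * deg i)) (tprod (axis i 1) (hom_act \<alpha> a k (\<lambda>u. t (i # u)))))"

definition gl_act :: "nat \<Rightarrow> gl11 \<Rightarrow> tensor \<Rightarrow> tensor" where
  "gl_act k a t = (\<Sum>\<alpha>\<in>{0, 1}. hom_act \<alpha> (component \<alpha> a) k t)"


section \<open>Endomorphism algebras\<close>

text \<open>Algebras over \<open>\<complex>\<close> are given as records of the type of modules, with \<open>smult\<close> the scalar
  multiplication.  Endomorphisms are extensional: \<open>undefined\<close> outside the tensor power.\<close>

definition End_algebra :: "nat \<Rightarrow> (complex, tensor \<Rightarrow> tensor) module" where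
  "End_algebra k =
     \<lparr>carrier = {T \<in> tensor_power k \<rightarrow>\<^sub>E tensor_power k.
          (\<forall>s\<in>tensor_power k. \<forall>t\<in>tensor_power k. T (s + t) = T s + T t) \<and>
          (\<forall>c. \<forall>t\<in>tensor_power k. T (tscale c t) = tscale c (T t))},
      monoid.mult = (\<lambda>S T. compose (tensor_power k) S T),
      one = (\<lambda>t\<in>tensor_power k. t),
      zero = (\<lambda>t\<in>tensor_power k. 0),
      add = (\<lambda>S T. \<lambda>t\<in>tensor_power k. S t + T t),
      smult = (\<lambda>c T. \<lambda>t\<in>tensor_power k. tscale c (T t))\<rparr>"

definition End_gl_algebra :: "nat \<Rightarrow> (complex, tensor \<Rightarrow> tensor) module" where
  "End_gl_algebra k = (End_algebra k)
     \<lparr>carrier := {T \<in> carrier (End_algebra k).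
        \<forall>a. \<forall>t\<in>tensor_power k. T (gl_act k a t) = gl_act k a (T t)}\<rparr>"

definition algebra_hom ::
  "(complex, 'a) module \<Rightarrow> (complex, 'b) module \<Rightarrow> ('a \<Rightarrow> 'b) set" where
  "algebra_hom A B =
     {h \<in> ring_hom A B. \<forall>c. \<forall>a\<in>carrier A. h (c \<odot>\<^bsub>A\<^esub> a) = c \<odot>\<^bsub>B\<^esub> h a}"


section \<open>The planar rook monoid and its algebra\<close>

text \<open>A planar rook diagram is an order-preserving partial injection \<open>d\<close>, with \<open>\<beta>(d) = dom d\<close> and
  \<open>\<tau>(d) = ran d\<close>.\<close>

definition planar_rook :: "nat \<Rightarrow> (nat \<rightharpoonup> nat) monoid" where
  "planar_rook n =
     \<lparr>carrier = {d. dom d \<subseteq> {1..n} \<and> ran d \<subseteq> {1..n} \<and> strict_mono_on (dom d) (the \<circ> d)},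
      monoid.mult = (\<circ>\<^sub>m),
      one = Some |` {1..n}\<rparr>"

definition support :: "('a \<Rightarrow> complex) \<Rightarrow> 'a set" where
  "support a = {g. a g \<noteq> 0}"

definition monoid_algebra :: "('a, 'b) monoid_scheme \<Rightarrow> (complex, 'a \<Rightarrow> complex) module" where
  "monoid_algebra G =
     \<lparr>carrier = {a. finite (support a) \<and> support a \<subseteq> carrier G},
      monoid.mult = (\<lambda>a b. \<lambda>g. \<Sum>(p, q)\<in>{(p, q) \<in> support a \<times> support b. p \<otimes>\<^bsub>G\<^esub> q = g}. a p * b q),
      one = (\<lambda>g. if g = \<one>\<^bsub>G\<^esub> then 1 else 0),
      zero = 0,
      add = (+),
      smult = (\<lambda>c a. \<lambda>g. c * a g)\<rparr>"

abbreviation planar_rook_algebra :: "nat \<Rightarrow> (complex, (nat \<rightharpoonup> nat) \<Rightarrow> complex) module" where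
  "planar_rook_algebra n \<equiv> monoid_algebra (planar_rook n)"


section \<open>The action of the planar rook algebra on the tensor power\<close>

definition u_vecs :: "nat \<Rightarrow> nat set \<Rightarrow> (complex^2) list" where
  "u_vecs k s = map (\<lambda>i. if i \<in> s then xvec else yvec) [1..<k]"

definition v_vec :: "nat \<Rightarrow> nat set \<Rightarrow> tensor" where
  "v_vec k s = gl_act k e_mat (pure_tensor (yvec # u_vecs k s))"

definition v_diagram :: "nat \<Rightarrow> (nat \<rightharpoonup> nat) \<Rightarrow> nat set \<Rightarrow> tensor" where
  "v_diagram k d s = (if s \<subseteq> dom d then v_vec k ((the \<circ> d) ` s) else 0)"

definition diagram_operator :: "nat \<Rightarrow> (nat \<rightharpoonup> nat) \<Rightarrow> (tensor \<Rightarrow> tensor) \<Rightarrow> bool" where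
  "diagram_operator k d T \<longleftrightarrow> T \<in> carrier (End_algebra k) \<and>
     (\<forall>s \<subseteq> {1..k - 1}. T (v_vec k s) = v_diagram k d s \<and>
        T (gl_act k f_mat (v_vec k s)) = gl_act k f_mat (v_diagram k d s))"

text \<open>The description below determines \<open>T\<close> because the \<open>v_vec k s\<close> and \<open>f (v_vec k s)\<close> form a basis.\<close>

definition rook_action :: "nat \<Rightarrow> ((nat \<rightharpoonup> nat) \<Rightarrow> complex) \<Rightarrow> tensor \<Rightarrow> tensor" where
  "rook_action k a =
     (\<lambda>t\<in>tensor_power k. \<Sum>d\<in>support a. tscale (a d) ((THE T. diagram_operator k d T) t))"

end

theory Submission
  imports Defs
begin

text \<open>
  Write \<open>e, f\<close> for the odd generators, \<open>h\<^sub>1\<close> for the first diagonal one and \<open>k = n + 1\<close>.  Everything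
  rests on four relations on the tensor power: \<open>e\<^sup>2 = 0\<close>, \<open>f\<^sup>2 = 0\<close>, \<open>e f + f e = k\<close>, and the fact that
  \<open>e\<close> raises and \<open>f\<close> lowers the \<open>h\<^sub>1\<close>-weight by one.

  The third relation makes \<open>t = (e (f t) + f (e t)) / k\<close>, where \<open>e (f t)\<close> and \<open>e t\<close> lie in the kernel of
  \<open>e\<close>.  A tensor \<open>t = x \<otimes> t\<^sub>1 + y \<otimes> t\<^sub>2\<close> in that kernel has \<open>t\<^sub>2 = - e t\<^sub>1\<close>, so it is determined by its
  slice \<open>t\<^sub>1\<close>, and the slice of \<open>v\<^sub>s = e (y \<otimes> u\<^sub>s)\<close> is the word \<open>u\<^sub>s\<close>.  Hence the \<open>v\<^sub>s\<close> form a basis of the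
  kernel, the \<open>v\<^sub>s\<close> and \<open>f v\<^sub>s\<close> together a basis of the whole tensor power, and all coordinates are
  explicit values of \<open>e (f t)\<close> and \<open>e t\<close> (\<open>raise_kernel_expansion\<close>, \<open>basis_expansion\<close>, \<open>coord_basis\<close>).

  An endomorphism \<open>T\<close> that commutes with \<open>gl(1|1)\<close> preserves the kernel of \<open>e\<close>, is determined by what it
  does there because \<open>T (f v\<^sub>s) = f (T v\<^sub>s)\<close>, and preserves the weight \<open>|s| + 1\<close> of \<open>v\<^sub>s\<close>; conversely these
  properties suffice (\<open>End_gl_iff\<close>).  So the centralizer is the algebra of matrices \<open>M r s\<close> indexed by
  subsets of \<open>{1..n}\<close> that vanish unless \<open>|r| = |s|\<close>.

  A diagram \<open>d\<close> acts by the sum of the matrix units \<open>E\<^bsub>d s, s\<^esub>\<close> over \<open>s \<subseteq> dom d\<close>.  For each pair with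
  \<open>|r| = |s|\<close> there is exactly one diagram with domain \<open>s\<close> and range \<open>r\<close>, since order isomorphisms of finite
  chains exist and are unique.  The matrix of this diagram is \<open>E\<^bsub>r, s\<^esub>\<close> plus units with smaller column
  index, so the passage from diagrams to matrix units is unitriangular and hence bijective
  (\<open>diagram_matrix_eq_0_imp\<close>, \<open>diagram_matrix_surj\<close>).
\<close>

section \<open>The generators of \<open>gl(1|1)\<close> on tensor powers\<close>

lemma sum_tensor_apply: "(\<Sum>i\<in>I. X i) w = (\<Sum>i\<in>I. (X i w :: complex))"
  by (induct I rule: infinite_finite_induct) auto

lemma hom_act_Nil [simp]: "hom_act \<alpha> a k t [] = 0"
  by (cases k) (auto simp: sum_tensor_apply tprod_def tscale_def)

text \<open>The recursion of the action seen from one word: the first factor is acted on directly, or it is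
  kept and the sign is paid for moving past it.  The properties of the generators follow from it
  by induction on the number of factors.\<close>

lemma hom_act_Cons [simp]:
  "hom_act \<alpha> a (Suc k) t (j # u) =
     (\<Sum>i\<in>UNIV. a $ j $ i * t (i # u)) + (- 1) ^ (\<alpha> * deg j) * hom_act \<alpha> a k (\<lambda>u. t (j # u)) u"
  using exhaust_2[of j]
  by (auto simp: sum_tensor_apply tprod_def tscale_def sum_2 axis_def matrix_vector_mult_def
      if_distrib sum.delta algebra_simps cong: if_cong)

lemma hom_act_add: "hom_act \<alpha> a k (s + t) = hom_act \<alpha> a k s + hom_act \<alpha> a k t"
proof (induct k arbitrary: s t)
  case (Suc k)
  have *: "(\<lambda>u. s (j # u) + t (j # u)) = (\<lambda>u. s (j # u)) + (\<lambda>u. t (j # u))" for j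
    by auto
  show ?case
  proof
    fix w show "hom_act \<alpha> a (Suc k) (s + t) w = (hom_act \<alpha> a (Suc k) s + hom_act \<alpha> a (Suc k) t) w"
      by (cases w) (simp_all del: hom_act.simps add: * Suc sum_2 algebra_simps)
  qed
qed auto

lemma hom_act_tscale: "hom_act \<alpha> a k (tscale c t) = tscale c (hom_act \<alpha> a k t)"
proof (induct k arbitrary: t)
  case 0 then show ?case by (auto simp: tscale_def)
next
  case (Suc k)
  have *: "(\<lambda>u. tscale c t (j # u)) = tscale c (\<lambda>u. t (j # u))" for j
    by (auto simp: tscale_def)
  show ?case
  proof
    fix w show "hom_act \<alpha> a (Suc k) (tscale c t) w = tscale c (hom_act \<alpha> a (Suc k) t) w"
      by (cases w) (simp_all del: hom_act.simps add: * Suc,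
          simp_all del: hom_act.simps add: tscale_def sum_2 algebra_simps)
  qed
qed

lemma hom_act_matrix_lincomb:
  "hom_act \<alpha> (\<chi> i j. c * a $ i $ j + d * b $ i $ j) k t =
     tscale c (hom_act \<alpha> a k t) + tscale d (hom_act \<alpha> b k t)"
proof (induct k arbitrary: t)
  case 0 then show ?case by (auto simp: tscale_def)
next
  case (Suc k)
  show ?case (is "?l = ?r")
  proof
    fix w show "?l w = ?r w"
      by (cases w) (simp_all del: hom_act.simps add: Suc,
          simp_all del: hom_act.simps add: tscale_def sum_2 algebra_simps)
  qed
qed

lemma hom_act_closed: "t \<in> tensor_power k \<Longrightarrow> hom_act \<alpha> a k t \<in> tensor_power k"
proof (induct k arbitrary: t)
  case 0 then show ?case by (auto simp: tensor_power_def)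
next
  case (Suc k)
  have *: "(\<lambda>u. t (j # u)) \<in> tensor_power k" for j
    using Suc(2) by (auto simp: tensor_power_def)
  show ?case unfolding tensor_power_def mem_Collect_eq
  proof (intro allI impI)
    fix w :: "2 list" assume "length w \<noteq> Suc k"
    then show "hom_act \<alpha> a (Suc k) t w = 0"
      using Suc(1)[OF *] Suc(2)
      by (cases w) (auto simp del: hom_act.simps simp: tensor_power_def)
  qed
qed

text \<open>Even elements act without signs, that is, as derivations, so on a word they act by the sum of the
  eigenvalues of its letters.\<close>

lemma hom_act_diagonal:
  assumes "\<And>i j. i \<noteq> j \<Longrightarrow> a $ i $ j = 0"
  shows "length w = k \<Longrightarrow> hom_act 0 a k t w = (\<Sum>i\<leftarrow>w. a $ i $ i) * t w"
proof (induct k arbitrary: t w)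
  case (Suc k)
  obtain j u where w: "w = j # u" using Suc(2) by (cases w) auto
  have "(\<Sum>i\<in>UNIV. a $ j $ i * t (i # u)) = a $ j $ j * t (j # u)"
    using assms exhaust_2[of j] by (auto simp: sum_2)
  then show ?case using Suc by (simp del: hom_act.simps add: w algebra_simps)
qed auto

definition raise :: "nat \<Rightarrow> tensor \<Rightarrow> tensor" where "raise k = gl_act k e_mat"
definition lower :: "nat \<Rightarrow> tensor \<Rightarrow> tensor" where "lower k = gl_act k f_mat"
text \<open>The action of \<open>h\<^sub>1\<close>, which counts the letters \<open>x\<close>; it does not depend on the length of the words.\<close>

definition weight :: "tensor \<Rightarrow> tensor" where
  "weight t = (\<lambda>w. of_nat (count_list w 1) * t w)"

lemma hom_act_zero_matrix: "hom_act \<alpha> (\<chi> i j. 0) k t = 0"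
  using hom_act_matrix_lincomb[of \<alpha> 0 0 0 0 k t] by (simp add: tscale_def fun_eq_iff)

lemma gl_mat_nth:
  "e_mat $ i $ j = (if i = 1 \<and> j = 2 then 1 else 0)"
  "f_mat $ i $ j = (if i = 2 \<and> j = 1 then 1 else 0)"
  using exhaust_2[of i] exhaust_2[of j] by (auto simp: e_mat_def f_mat_def)

lemma component_e_f:
  "component 0 e_mat = (\<chi> i j. 0)" "component (Suc 0) e_mat = e_mat"
  "component 0 f_mat = (\<chi> i j. 0)" "component (Suc 0) f_mat = f_mat"
  by (auto simp: component_def vec_eq_iff gl_mat_nth deg_def)

lemma raise_eq: "raise k t = hom_act 1 e_mat k t"
  and lower_eq: "lower k t = hom_act 1 f_mat k t"
  by (simp_all add: raise_def lower_def gl_act_def component_e_f hom_act_zero_matrix)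

lemma raise_Nil [simp]: "raise k t [] = 0" and lower_Nil [simp]: "lower k t [] = 0"
  by (simp_all add: raise_eq lower_eq)

text \<open>With \<open>t = x \<otimes> t\<^sub>1 + y \<otimes> t\<^sub>2\<close> these read \<open>e t = x \<otimes> (t\<^sub>2 + e t\<^sub>1) - y \<otimes> e t\<^sub>2\<close>.  Comparing slices
  reduces an identity of operators to the identities for one factor less.\<close>

lemma raise_slices:
  "(\<lambda>u. raise (Suc k) t (1 # u)) = (\<lambda>u. t (2 # u)) + raise k (\<lambda>u. t (1 # u))"
  "(\<lambda>u. raise (Suc k) t (2 # u)) = - raise k (\<lambda>u. t (2 # u))"
  by (auto simp del: hom_act.simps simp: raise_eq sum_2 gl_mat_nth deg_def)

lemma lower_slices:
  "(\<lambda>u. lower (Suc k) t (1 # u)) = lower k (\<lambda>u. t (1 # u))"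
  "(\<lambda>u. lower (Suc k) t (2 # u)) = (\<lambda>u. t (1 # u)) - lower k (\<lambda>u. t (2 # u))"
  by (auto simp del: hom_act.simps simp: lower_eq sum_2 gl_mat_nth deg_def)

text \<open>Since \<open>h\<^sub>1 + h\<^sub>2\<close> is the identity matrix, it acts as the scalar \<open>k\<close>; so \<open>e\<close>, \<open>f\<close> and \<open>h\<^sub>1\<close> carry
  the whole action.\<close>

lemma gl_act_eq:
  assumes "t \<in> tensor_power k"
  shows "gl_act k a t = tscale (a $ 1 $ 2) (raise k t) + tscale (a $ 2 $ 1) (lower k t)
    + tscale (a $ 1 $ 1 - a $ 2 $ 2) (weight t) + tscale (of_nat k * a $ 2 $ 2) t"
proof -
  have c1: "component (Suc 0) a = (\<chi> i j. a $ 1 $ 2 * e_mat $ i $ j + a $ 2 $ 1 * f_mat $ i $ j)"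
  proof -
    have "component (Suc 0) a $ i $ j = a $ 1 $ 2 * e_mat $ i $ j + a $ 2 $ 1 * f_mat $ i $ j" for i j
      using exhaust_2[of i] exhaust_2[of j] by (auto simp: component_def gl_mat_nth deg_def)
    then show ?thesis by (simp add: vec_eq_iff)
  qed
  have sl: "(\<Sum>i\<leftarrow>w. a $ i $ i) = (a $ 1 $ 1 - a $ 2 $ 2) * of_nat (count_list w 1) + of_nat (length w) * a $ 2 $ 2"
    for w :: "2 list"
  proof (induct w)
    case (Cons i w) then show ?case using exhaust_2[of i] by (auto simp: algebra_simps)
  qed simp
  have c0: "component 0 a $ i $ i = a $ i $ i" for i
    by (auto simp: component_def deg_def)
  have d: "i \<noteq> j \<Longrightarrow> component 0 a $ i $ j = 0" for i j
    using exhaust_2[of i] exhaust_2[of j] by (auto simp: component_def deg_def)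
  have "hom_act 0 (component 0 a) k t w = (a $ 1 $ 1 - a $ 2 $ 2) * weight t w + of_nat k * a $ 2 $ 2 * t w" for w
  proof (cases "length w = k")
    case True
    show ?thesis using hom_act_diagonal[OF d True, of t] sl[of w] True
      by (simp add: c0 weight_def algebra_simps)
  next
    case False
    then show ?thesis using assms hom_act_closed[OF assms, of 0 "component 0 a"]
      by (simp add: tensor_power_def weight_def)
  qed
  then show ?thesis
    by (auto simp: gl_act_def c1 hom_act_matrix_lincomb raise_eq lower_eq tscale_def)
qed

lemma raise_linear [simp]: "raise k (s + t) = raise k s + raise k t"
  "raise k (tscale c t) = tscale c (raise k t)"
  "raise k (- t) = - raise k t" "raise k (s - t) = raise k s - raise k t" "raise k 0 = 0"
proof -
  show a: "raise k (s + t) = raise k s + raise k t" for s t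
    by (simp add: raise_eq hom_act_add)
  show b: "raise k (tscale c t) = tscale c (raise k t)" for c t by (simp add: raise_eq hom_act_tscale)
  have neg: "- t = tscale (-1) t" for t by (auto simp: tscale_def)
  show c: "raise k (- t) = - raise k t" for t by (simp only: neg b)
  show "raise k (s - t) = raise k s - raise k t" for s t
    using a[of s "-t"] c by simp
  show "raise k 0 = 0"
    using a[of 0 0] by simp
qed

lemma lower_linear [simp]: "lower k (s + t) = lower k s + lower k t"
  "lower k (tscale c t) = tscale c (lower k t)"
  "lower k (- t) = - lower k t" "lower k (s - t) = lower k s - lower k t" "lower k 0 = 0"
proof -
  show a: "lower k (s + t) = lower k s + lower k t" for s t
    by (simp add: lower_eq hom_act_add)
  show b: "lower k (tscale c t) = tscale c (lower k t)" for c t by (simp add: lower_eq hom_act_tscale)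
  have neg: "- t = tscale (-1) t" for t by (auto simp: tscale_def)
  show c: "lower k (- t) = - lower k t" for t by (simp only: neg b)
  show "lower k (s - t) = lower k s - lower k t" for s t
    using a[of s "-t"] c by simp
  show "lower k 0 = 0"
    using a[of 0 0] by simp
qed

lemma tensor_eqI:
  assumes "s [] = (t [] :: complex)" "(\<lambda>u. s ((1::2) # u)) = (\<lambda>u. t (1 # u))"
    "(\<lambda>u. s (2 # u)) = (\<lambda>u. t (2 # u))"
  shows "s = t"
proof
  fix w :: "2 list"
  show "s w = t w"
  proof (cases w)
    case (Cons j u)
    then show ?thesis using assms(2,3) exhaust_2[of j] by (auto simp: fun_eq_iff)
  qed (use assms in auto)
qed

lemma slice_arith:
  fixes X Y :: tensor
  shows "(\<lambda>u. (X + Y) (j # u)) = (\<lambda>u. X (j # u)) + (\<lambda>u. Y (j # u))"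
    and "(\<lambda>u. (X - Y) (j # u)) = (\<lambda>u. X (j # u)) - (\<lambda>u. Y (j # u))"
  by auto

lemma raise_raise [simp]: "raise k (raise k t) = 0"
proof (induct k arbitrary: t)
  case 0 show ?case by (simp add: raise_eq)
next
  case (Suc k)
  show ?case by (rule tensor_eqI) (simp_all add: Suc raise_slices zero_fun_def[symmetric])
qed

lemma lower_lower [simp]: "lower k (lower k t) = 0"
proof (induct k arbitrary: t)
  case 0 show ?case by (simp add: lower_eq)
next
  case (Suc k)
  show ?case by (rule tensor_eqI) (simp_all add: Suc lower_slices zero_fun_def[symmetric])
qed

text \<open>The matrix identity \<open>e f + f e = 1\<close> is the bracket of the two odd generators, and the identity
  matrix acts as the number of tensor factors.\<close>

lemma raise_lower_tensor_power:
  "t \<in> tensor_power k \<Longrightarrow> raise k (lower k t) + lower k (raise k t) = tscale (of_nat k) t"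
proof (induct k arbitrary: t)
  case 0
  then show ?case by (simp add: raise_eq lower_eq fun_eq_iff tscale_def)
next
  case (Suc k)
  let ?s = "\<lambda>j. (\<lambda>u. t (j # u))"
  have "?s j \<in> tensor_power k" for j
    using Suc(2) by (auto simp: tensor_power_def)
  then have IH: "raise k (lower k (?s j)) + lower k (raise k (?s j)) = tscale (of_nat k) (?s j)" for j
    by (rule Suc(1))
  have sc: "(\<lambda>u. tscale (of_nat (Suc k)) t (j # u)) = ?s j + tscale (of_nat k) (?s j)" for j
    by (simp add: fun_eq_iff tscale_def algebra_simps)
  show ?case
  proof (rule tensor_eqI)
    show "(raise (Suc k) (lower (Suc k) t) + lower (Suc k) (raise (Suc k) t)) [] = tscale (of_nat (Suc k)) t []"
      using Suc(2) by (simp add: tensor_power_def tscale_def)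
    show "(\<lambda>u. (raise (Suc k) (lower (Suc k) t) + lower (Suc k) (raise (Suc k) t)) (1 # u)) =
        (\<lambda>u. tscale (of_nat (Suc k)) t (1 # u))"
      by (simp only: slice_arith sc IH[symmetric] raise_slices lower_slices raise_linear lower_linear)
        (simp add: algebra_simps)
    show "(\<lambda>u. (raise (Suc k) (lower (Suc k) t) + lower (Suc k) (raise (Suc k) t)) (2 # u)) =
        (\<lambda>u. tscale (of_nat (Suc k)) t (2 # u))"
      by (simp only: slice_arith sc IH[symmetric] raise_slices lower_slices raise_linear lower_linear)
        (simp add: algebra_simps)
  qed
qed

lemma weight_slices:
  "(\<lambda>u. weight t (1 # u)) = weight (\<lambda>u. t (1 # u)) + (\<lambda>u. t (1 # u))"
  "(\<lambda>u. weight t (2 # u)) = weight (\<lambda>u. t (2 # u))"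
  by (auto simp: weight_def algebra_simps)

lemma weight_linear [simp]: "weight (s + t) = weight s + weight t"
  "weight (tscale c t) = tscale c (weight t)" "weight (-t) = - weight t" "weight (s - t) = weight s - weight t"
  "weight 0 = 0"
  by (auto simp: weight_def algebra_simps tscale_def)

lemma weight_Nil [simp]: "weight t [] = 0" by (simp add: weight_def)

text \<open>The bracket \<open>[h\<^sub>1, e] = e\<close>.\<close>

lemma weight_raise: "weight (raise k t) = raise k (weight t) + raise k t"
proof (induct k arbitrary: t)
  case 0 show ?case by (rule ext) (simp add: raise_eq weight_def)
next
  case (Suc k)
  show ?case
    by (rule tensor_eqI)
      (simp, simp_all only: slice_arith raise_slices weight_slices raise_linear weight_linear Suc,
        simp_all add: fun_eq_iff algebra_simps)
qed

text \<open>The bracket \<open>[h\<^sub>1, f] = - f\<close>.\<close>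

lemma weight_lower: "weight (lower k t) = lower k (weight t) - lower k t"
proof (induct k arbitrary: t)
  case 0 show ?case by (rule ext) (simp add: lower_eq weight_def)
next
  case (Suc k)
  show ?case
    by (rule tensor_eqI)
      (simp, simp_all only: slice_arith lower_slices weight_slices lower_linear weight_linear Suc,
        simp_all add: fun_eq_iff algebra_simps)
qed


section \<open>The basis of \<open>v\<^sub>s\<close> and \<open>f v\<^sub>s\<close>\<close>

lemma tensor_power_zero [simp]: "0 \<in> tensor_power k"
  and tensor_power_add: "s \<in> tensor_power k \<Longrightarrow> t \<in> tensor_power k \<Longrightarrow> s + t \<in> tensor_power k"
  and tensor_power_tscale: "t \<in> tensor_power k \<Longrightarrow> tscale c t \<in> tensor_power k"
  by (auto simp: tensor_power_def tscale_def)

lemma tensor_power_sum: "(\<And>i. i \<in> I \<Longrightarrow> x i \<in> tensor_power k) \<Longrightarrow> (\<Sum>i\<in>I. x i) \<in> tensor_power k"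
  by (induct I rule: infinite_finite_induct) (auto intro: tensor_power_add)

lemma raise_closed: "t \<in> tensor_power k \<Longrightarrow> raise k t \<in> tensor_power k"
  and lower_closed: "t \<in> tensor_power k \<Longrightarrow> lower k t \<in> tensor_power k"
  by (simp_all add: raise_eq lower_eq hom_act_closed)

text \<open>Linearity is required on the tensor power only, because extensional endomorphisms have the
  value \<open>undefined\<close> outside it.\<close>

definition tensor_linear :: "nat \<Rightarrow> (tensor \<Rightarrow> tensor) \<Rightarrow> bool" where
  "tensor_linear k X \<longleftrightarrow> X \<in> tensor_power k \<rightarrow> tensor_power k \<and>
     (\<forall>s\<in>tensor_power k. \<forall>t\<in>tensor_power k. X (s + t) = X s + X t) \<and>
     (\<forall>c. \<forall>t\<in>tensor_power k. X (tscale c t) = tscale c (X t))"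

lemma tensor_linear_closed: "tensor_linear k X \<Longrightarrow> t \<in> tensor_power k \<Longrightarrow> X t \<in> tensor_power k"
  by (auto simp: tensor_linear_def)

lemma tensor_linear_raise: "tensor_linear k (raise k)"
  and tensor_linear_lower: "tensor_linear k (lower k)"
  by (auto simp: tensor_linear_def raise_closed lower_closed)

lemma tensor_linear_comp: "tensor_linear k X \<Longrightarrow> tensor_linear k Y \<Longrightarrow> tensor_linear k (\<lambda>t. X (Y t))"
  by (auto simp: tensor_linear_def Pi_iff)

lemma tscale_0 [simp]: "tscale 0 t = 0" by (auto simp: tscale_def)
lemma tscale_1 [simp]: "tscale 1 t = t" by (auto simp: tscale_def)
lemma tscale_zero [simp]: "tscale c 0 = 0" by (auto simp: tscale_def)

lemma tensor_linear_0: "tensor_linear k X \<Longrightarrow> X 0 = 0"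
  unfolding tensor_linear_def using tscale_0 tensor_power_zero by metis

lemma tensor_linear_sum:
  assumes "tensor_linear k X"
  shows "(\<And>i. i \<in> I \<Longrightarrow> x i \<in> tensor_power k) \<Longrightarrow> X (\<Sum>i\<in>I. x i) = (\<Sum>i\<in>I. X (x i))"
proof (induct I rule: infinite_finite_induct)
  case (insert i I)
  have "X (x i + (\<Sum>i\<in>I. x i)) = X (x i) + X (\<Sum>i\<in>I. x i)"
    using assms insert(4) tensor_power_sum[of I x k] by (auto simp: tensor_linear_def)
  moreover have "X (\<Sum>i\<in>I. x i) = (\<Sum>i\<in>I. X (x i))"
    by (rule insert(3)) (simp add: insert(4))
  ultimately show ?case by (simp only: sum.insert[OF insert(1,2)])
qed (auto simp: tensor_linear_0[OF assms])

lemma tensor_linear_tscale: "tensor_linear k X \<Longrightarrow> t \<in> tensor_power k \<Longrightarrow> X (tscale c t) = tscale c (X t)"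
  by (auto simp: tensor_linear_def)

lemma tensor_linear_add:
  "tensor_linear k X \<Longrightarrow> s \<in> tensor_power k \<Longrightarrow> t \<in> tensor_power k \<Longrightarrow> X (s + t) = X s + X t"
  by (auto simp: tensor_linear_def)

lemma carrier_End_algebra:
  "T \<in> carrier (End_algebra k) \<longleftrightarrow> T \<in> extensional (tensor_power k) \<and> tensor_linear k T"
  by (auto simp: End_algebra_def tensor_linear_def PiE_def)

definition subset_word :: "nat \<Rightarrow> nat set \<Rightarrow> 2 list" where
  "subset_word n s = map (\<lambda>i. if i \<in> s then 1 else 2) [1..<Suc n]"

lemma length_subset_word [simp]: "length (subset_word n s) = n"
  by (simp add: subset_word_def)

lemma count_subset_word: "s \<subseteq> {1..n} \<Longrightarrow> count_list (subset_word n s) 1 = card s"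
proof -
  have "count_list (map (\<lambda>i. if i \<in> s then 1 else (2::2)) xs) 1 = card (s \<inter> set xs)" if "distinct xs" for xs
    using that by (induct xs) (auto simp: Int_insert_right)
  from this[of "[1..<Suc n]"] show "s \<subseteq> {1..n} \<Longrightarrow> count_list (subset_word n s) 1 = card s"
    by (simp add: subset_word_def atLeastLessThanSuc_atLeastAtMost Int_absorb2 del: upt_Suc)
qed

lemma subset_word_inj: "inj_on (subset_word n) (Pow {1..n})"
proof (rule inj_onI)
  fix s r assume sr: "s \<in> Pow {1..n}" "r \<in> Pow {1..n}" and eq: "subset_word n s = subset_word n r"
  have "i \<in> s \<longleftrightarrow> i \<in> r" if "i \<in> {1..n}" for i
  proof -
    have "(if i \<in> s then 1 else 2) = (if i \<in> r then 1 else (2::2))"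
      using eq that unfolding subset_word_def map_eq_conv by (simp del: upt_Suc)
    then show ?thesis by (simp split: if_splits)
  qed
  then show "s = r" using sr by blast
qed

lemma subset_word_surj:
  assumes "length w = n" shows "\<exists>s\<in>Pow {1..n}. subset_word n s = w"
proof (intro bexI)
  show "subset_word n {i \<in> {1..n}. w ! (i - 1) = 1} = w"
  proof (rule nth_equalityI)
    fix i assume "i < length (subset_word n {i \<in> {1..n}. w ! (i - 1) = 1})"
    then show "subset_word n {i \<in> {1..n}. w ! (i - 1) = 1} ! i = w ! i"
      using exhaust_2[of "w ! i"] by (auto simp: subset_word_def nth_append simp del: upt_Suc)
  qed (use assms in simp)
qed auto

lemma pure_tensor_axis: "pure_tensor (map (\<lambda>i. axis i 1) w) = (\<lambda>u. if u = w then 1 else 0)"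
proof (induct w)
  case (Cons i w)
  then show ?case by (auto simp: fun_eq_iff tprod_def axis_def split: list.split)
qed (auto simp: fun_eq_iff)

lemma pure_tensor_u_vecs: "pure_tensor (u_vecs (Suc n) s) = (\<lambda>u. if u = subset_word n s then 1 else 0)"
proof -
  have "u_vecs (Suc n) s = map (\<lambda>i. axis i 1) (subset_word n s)"
    by (auto simp: u_vecs_def subset_word_def xvec_def yvec_def)
  then show ?thesis by (simp add: pure_tensor_axis)
qed

lemma v_vec_eq: "v_vec (Suc n) s = raise (Suc n) (tprod yvec (\<lambda>u. if u = subset_word n s then 1 else 0))"
  by (simp add: v_vec_def raise_def pure_tensor_u_vecs)

lemma v_vec_closed: "v_vec (Suc n) s \<in> tensor_power (Suc n)"
  unfolding v_vec_eq
  by (rule raise_closed) (auto simp: tensor_power_def tprod_def split: list.split)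

lemma raise_v_vec [simp]: "raise (Suc n) (v_vec (Suc n) s) = 0"
  by (simp add: v_vec_eq)

text \<open>Since \<open>v\<^sub>s = x \<otimes> u\<^sub>s - y \<otimes> e u\<^sub>s\<close>, the words that begin with \<open>x\<close> see only \<open>u\<^sub>s\<close>; they serve as
  coordinate functions for the \<open>v\<^sub>s\<close>.\<close>

lemma v_vec_slice: "v_vec (Suc n) s (1 # u) = (if u = subset_word n s then 1 else 0)"
  using fun_cong[OF raise_slices(1)[of n "tprod yvec (\<lambda>u. if u = subset_word n s then 1 else 0)"], of u]
  by (simp add: v_vec_eq tprod_def yvec_def axis_def zero_fun_def[symmetric])

lemma v_vec_coordinate:
  "s \<subseteq> {1..n} \<Longrightarrow> r \<subseteq> {1..n} \<Longrightarrow> v_vec (Suc n) s (1 # subset_word n r) = (if r = s then 1 else 0)"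
  using subset_word_inj[of n] by (auto simp: v_vec_slice inj_on_def)

text \<open>The \<open>x\<close>-slice of \<open>e t\<close> is \<open>t\<^sub>2 + e t\<^sub>1\<close>, so on the kernel of \<open>e\<close> the slice \<open>t\<^sub>1\<close> determines \<open>t\<close>.\<close>

lemma raise_kernel_eq_0:
  assumes "raise (Suc n) t = 0" "t [] = 0" "(\<lambda>u. t (1 # u)) = 0"
  shows "t = 0"
proof (rule tensor_eqI)
  have "(\<lambda>u. t (2 # u)) = (\<lambda>u. raise (Suc n) t (1 # u))"
    unfolding raise_slices(1) by (simp add: assms(3))
  then show "(\<lambda>u. t (2 # u)) = (\<lambda>u. 0 (2 # u))" by (simp add: assms(1))
qed (use assms in \<open>auto simp: zero_fun_def\<close>)

text \<open>Both sides lie in the kernel of \<open>e\<close> and have the same \<open>x\<close>-slice, which is a combination of words.\<close>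

lemma raise_kernel_expansion:
  assumes "t \<in> tensor_power (Suc n)" "raise (Suc n) t = 0"
  shows "t = (\<Sum>s\<in>Pow {1..n}. tscale (t (1 # subset_word n s)) (v_vec (Suc n) s))" (is "t = ?r")
proof -
  have rr: "raise (Suc n) ?r = 0"
    by (simp add: tensor_linear_sum[OF tensor_linear_raise] tensor_power_tscale v_vec_closed)
  have slice: "(\<lambda>u. (t - ?r) (1 # u)) = 0"
  proof
    fix u
    show "(t - ?r) (1 # u) = 0 u"
    proof (cases "length u = n")
      case True
      then obtain r where r: "r \<in> Pow {1..n}" "u = subset_word n r"
        using subset_word_surj by metis
      have "?r (1 # u) = (\<Sum>s\<in>Pow {1..n}. if s = r then t (1 # u) else 0)"
        unfolding sum_tensor_apply
        using r by (intro sum.cong) (auto simp: tscale_def v_vec_coordinate)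
      then show ?thesis using r by (simp add: sum.delta)
    next
      case False
      then have "1 # u \<notin> {w. length w = Suc n}" by simp
      moreover have "?r \<in> tensor_power (Suc n)"
        by (intro tensor_power_sum tensor_power_tscale v_vec_closed)
      ultimately show ?thesis using assms(1) by (simp add: tensor_power_def)
    qed
  qed
  have nil: "(t - ?r) [] = 0"
    using assms(1) v_vec_closed[of n] by (simp add: tensor_power_def sum_tensor_apply tscale_def)
  have "raise (Suc n) (t - ?r) = 0"
    unfolding raise_linear rr assms(2) by simp
  then have "t - ?r = 0"
    by (rule raise_kernel_eq_0[OF _ nil slice])
  then show ?thesis by simp
qed

text \<open>The coordinates come from \<open>k t = e (f t) + f (e t)\<close>: the first summand lies in the kernel of \<open>e\<close>, the
  second is the image under \<open>f\<close> of such a tensor, and coefficients in the kernel are read off at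
  the words that begin with \<open>x\<close>.\<close>

definition coord_v :: "nat \<Rightarrow> tensor \<Rightarrow> nat set \<Rightarrow> complex" where
  "coord_v n t s = raise (Suc n) (lower (Suc n) t) (1 # subset_word n s) / of_nat (Suc n)"

definition coord_fv :: "nat \<Rightarrow> tensor \<Rightarrow> nat set \<Rightarrow> complex" where
  "coord_fv n t s = raise (Suc n) t (1 # subset_word n s) / of_nat (Suc n)"

lemma basis_expansion:
  assumes t: "t \<in> tensor_power (Suc n)"
  shows "t = (\<Sum>s\<in>Pow {1..n}. tscale (coord_v n t s) (v_vec (Suc n) s) +
    tscale (coord_fv n t s) (lower (Suc n) (v_vec (Suc n) s)))"
proof -
  let ?k = "of_nat (Suc n) :: complex"
  have k0: "?k \<noteq> 0" by (simp del: of_nat_Suc)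
  let ?a = "raise (Suc n) (lower (Suc n) t)" and ?b = "raise (Suc n) t"
  note cl = raise_closed lower_closed t
  have a: "?a = (\<Sum>s\<in>Pow {1..n}. tscale (?a (1 # subset_word n s)) (v_vec (Suc n) s))"
    by (rule raise_kernel_expansion) (simp_all add: cl)
  have b: "?b = (\<Sum>s\<in>Pow {1..n}. tscale (?b (1 # subset_word n s)) (v_vec (Suc n) s))"
    by (rule raise_kernel_expansion) (simp_all add: cl)
  have c: "lower (Suc n) ?b = (\<Sum>s\<in>Pow {1..n}. tscale (?b (1 # subset_word n s)) (lower (Suc n) (v_vec (Suc n) s)))"
    by (subst b) (simp add: tensor_linear_sum[OF tensor_linear_lower] tensor_power_tscale v_vec_closed)
  show ?thesis
  proof
    fix w
    have "?k * t w = (?a + lower (Suc n) ?b) w"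
      by (simp only: raise_lower_tensor_power[OF t]) (simp add: tscale_def)
    also have "\<dots> = (\<Sum>s\<in>Pow {1..n}. ?a (1 # subset_word n s) * v_vec (Suc n) s w +
        ?b (1 # subset_word n s) * lower (Suc n) (v_vec (Suc n) s) w)"
      by (subst a, subst c) (simp add: sum_tensor_apply sum.distrib tscale_def)
    finally have "t w = (\<Sum>s\<in>Pow {1..n}. ?a (1 # subset_word n s) * v_vec (Suc n) s w +
        ?b (1 # subset_word n s) * lower (Suc n) (v_vec (Suc n) s) w) / ?k"
      using k0 by (simp add: field_simps)
    then show "t w = (\<Sum>s\<in>Pow {1..n}. tscale (coord_v n t s) (v_vec (Suc n) s) +
       tscale (coord_fv n t s) (lower (Suc n) (v_vec (Suc n) s))) w"
      by (simp add: sum_tensor_apply tscale_def coord_v_def coord_fv_def sum_divide_distrib add_divide_distrib)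
  qed
qed

lemma raise_lower_v_vec:
  "raise (Suc n) (lower (Suc n) (v_vec (Suc n) s)) = tscale (of_nat (Suc n)) (v_vec (Suc n) s)"
  using raise_lower_tensor_power[OF v_vec_closed, of n s] by simp

text \<open>The expansion gives spanning; this gives independence.  It follows from \<open>e v\<^sub>r = 0\<close>, \<open>f\<^sup>2 = 0\<close> and
  \<open>e (f v\<^sub>r) = k v\<^sub>r\<close>.\<close>

lemma coord_basis:
  assumes "r \<subseteq> {1..n}" "s \<subseteq> {1..n}"
  shows "coord_v n (v_vec (Suc n) r) s = (if s = r then 1 else 0)"
    and "coord_fv n (v_vec (Suc n) r) s = 0"
    and "coord_v n (lower (Suc n) (v_vec (Suc n) r)) s = 0"
    and "coord_fv n (lower (Suc n) (v_vec (Suc n) r)) s = (if s = r then 1 else 0)"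
proof -
  have k0: "complex_of_nat (Suc n) \<noteq> 0" by (simp del: of_nat_Suc)
  show "coord_v n (v_vec (Suc n) r) s = (if s = r then 1 else 0)"
    "coord_fv n (lower (Suc n) (v_vec (Suc n) r)) s = (if s = r then 1 else 0)"
    unfolding coord_v_def coord_fv_def raise_lower_v_vec tscale_def v_vec_coordinate[OF assms]
    using k0 by simp_all
  show "coord_fv n (v_vec (Suc n) r) s = 0" "coord_v n (lower (Suc n) (v_vec (Suc n) r)) s = 0"
    unfolding coord_v_def coord_fv_def raise_v_vec lower_lower raise_linear by simp_all
qed

lemma tensor_linear_eqI:
  assumes X: "tensor_linear (Suc n) X" and Y: "tensor_linear (Suc n) Y"
    and v: "\<And>s. s \<subseteq> {1..n} \<Longrightarrow> X (v_vec (Suc n) s) = Y (v_vec (Suc n) s)"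
    and fv: "\<And>s. s \<subseteq> {1..n} \<Longrightarrow> X (lower (Suc n) (v_vec (Suc n) s)) = Y (lower (Suc n) (v_vec (Suc n) s))"
    and t: "t \<in> tensor_power (Suc n)"
  shows "X t = Y t"
proof -
  note cl = tensor_power_add tensor_power_tscale v_vec_closed lower_closed
  have expand: "Z t = (\<Sum>s\<in>Pow {1..n}. tscale (coord_v n t s) (Z (v_vec (Suc n) s)) +
    tscale (coord_fv n t s) (Z (lower (Suc n) (v_vec (Suc n) s))))" if Z: "tensor_linear (Suc n) Z" for Z
    by (subst basis_expansion[OF t])
      (simp add: cl tensor_linear_sum[OF Z] tensor_linear_add[OF Z] tensor_linear_tscale[OF Z])
  show ?thesis
    unfolding expand[OF X] expand[OF Y] by (intro sum.cong refl) (simp only: v fv Pow_iff)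
qed

lemma coord_linear:
  "coord_v n (s + t) r = coord_v n s r + coord_v n t r"
  "coord_fv n (s + t) r = coord_fv n s r + coord_fv n t r"
  "coord_v n (tscale c t) r = c * coord_v n t r"
  "coord_fv n (tscale c t) r = c * coord_fv n t r"
  unfolding coord_v_def coord_fv_def raise_linear lower_linear
  by (simp_all add: tscale_def add_divide_distrib)

text \<open>The operator with \<open>v\<^sub>s \<mapsto> g s\<close> and \<open>f v\<^sub>s \<mapsto> f (g s)\<close>.\<close>

definition basis_ext :: "nat \<Rightarrow> (nat set \<Rightarrow> tensor) \<Rightarrow> tensor \<Rightarrow> tensor" where
  "basis_ext n g = (\<lambda>t\<in>tensor_power (Suc n). \<Sum>s\<in>Pow {1..n}. tscale (coord_v n t s) (g s) +
     tscale (coord_fv n t s) (lower (Suc n) (g s)))"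

lemma basis_ext:
  assumes g: "\<And>s. s \<subseteq> {1..n} \<Longrightarrow> g s \<in> tensor_power (Suc n)"
  shows "basis_ext n g \<in> carrier (End_algebra (Suc n))"
    and "s \<subseteq> {1..n} \<Longrightarrow> basis_ext n g (v_vec (Suc n) s) = g s"
    and "s \<subseteq> {1..n} \<Longrightarrow> basis_ext n g (lower (Suc n) (v_vec (Suc n) s)) = lower (Suc n) (g s)"
proof -
  note cl = tensor_power_add tensor_power_tscale v_vec_closed lower_closed
  have "basis_ext n g t \<in> tensor_power (Suc n)" if "t \<in> tensor_power (Suc n)" for t
    using that g by (auto simp: basis_ext_def intro!: tensor_power_sum cl)
  moreover have "basis_ext n g (t + u) = basis_ext n g t + basis_ext n g u"
    if "t \<in> tensor_power (Suc n)" "u \<in> tensor_power (Suc n)" for t u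
    using that by (simp only: basis_ext_def restrict_apply if_True tensor_power_add)
      (simp add: fun_eq_iff sum_tensor_apply coord_linear tscale_def sum.distrib algebra_simps)
  moreover have "basis_ext n g (tscale c t) = tscale c (basis_ext n g t)"
    if "t \<in> tensor_power (Suc n)" for c t
    using that by (simp only: basis_ext_def restrict_apply if_True tensor_power_tscale coord_linear)
      (simp add: fun_eq_iff sum_tensor_apply tscale_def sum_distrib_left algebra_simps)
  ultimately show "basis_ext n g \<in> carrier (End_algebra (Suc n))"
    unfolding carrier_End_algebra tensor_linear_def by (auto simp: basis_ext_def)
  assume s: "s \<subseteq> {1..n}"
  have v: "basis_ext n g t = (\<Sum>r\<in>Pow {1..n}. tscale (coord_v n t r) (g r) +
      tscale (coord_fv n t r) (lower (Suc n) (g r)))"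
    if "t \<in> tensor_power (Suc n)" for t
    using that by (simp add: basis_ext_def)
  have "basis_ext n g (v_vec (Suc n) s) = (\<Sum>r\<in>Pow {1..n}. if r = s then g s else 0)"
    unfolding v[OF v_vec_closed] by (rule sum.cong) (use s in \<open>auto simp: coord_basis\<close>)
  then show "basis_ext n g (v_vec (Suc n) s) = g s" using s by simp
  have "basis_ext n g (lower (Suc n) (v_vec (Suc n) s)) = (\<Sum>r\<in>Pow {1..n}. if r = s then lower (Suc n) (g s) else 0)"
    unfolding v[OF lower_closed[OF v_vec_closed]] by (rule sum.cong) (use s in \<open>auto simp: coord_basis\<close>)
  then show "basis_ext n g (lower (Suc n) (v_vec (Suc n) s)) = lower (Suc n) (g s)" using s by simp
qed

text \<open>The tensor \<open>y \<otimes> u\<^sub>s\<close> has \<open>|s|\<close> letters \<open>x\<close>, and \<open>e\<close> adds one.\<close>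

lemma weight_v_vec:
  assumes "s \<subseteq> {1..n}"
  shows "weight (v_vec (Suc n) s) = tscale (of_nat (Suc (card s))) (v_vec (Suc n) s)"
proof -
  let ?t = "tprod yvec (\<lambda>u. if u = subset_word n s then 1 else 0)"
  have "weight ?t = tscale (of_nat (card s)) ?t"
    using count_subset_word[OF assms]
    by (auto simp: fun_eq_iff weight_def tscale_def tprod_def yvec_def axis_def split: list.split)
  then show ?thesis by (simp add: v_vec_eq weight_raise) (simp add: fun_eq_iff tscale_def algebra_simps)
qed


section \<open>Planar rook diagrams and weight-preserving matrices\<close>

lemma carrier_planar_rook:
  "d \<in> carrier (planar_rook n) \<longleftrightarrow>
     dom d \<subseteq> {1..n} \<and> ran d \<subseteq> {1..n} \<and> strict_mono_on (dom d) (the \<circ> d)"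
  by (simp add: planar_rook_def)

lemma finite_planar_rook: "finite (carrier (planar_rook n))"
proof -
  have "finite (\<Union>A\<in>Pow {1..n}. {d :: nat \<rightharpoonup> nat. dom d = A \<and> ran d \<subseteq> {1..n}})"
    using finite_set_of_finite_maps[of _ "{1..n}"] finite_subset[of _ "{1..n}"] by blast
  then show ?thesis
    by (rule rev_finite_subset) (use carrier_planar_rook in blast)
qed

lemma diagram_image_subset:
  "d \<in> carrier (planar_rook n) \<Longrightarrow> s \<subseteq> dom d \<Longrightarrow> (the \<circ> d) ` s \<subseteq> {1..n}"
  by (force simp: carrier_planar_rook intro: ranI)

lemma card_diagram_image:
  "d \<in> carrier (planar_rook n) \<Longrightarrow> s \<subseteq> dom d \<Longrightarrow> card ((the \<circ> d) ` s) = card s"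
  by (intro card_image inj_on_subset[OF strict_mono_on_imp_inj_on, of "dom d"]) (simp_all add: carrier_planar_rook)

text \<open>Increasing maps carry the sorted list of \<open>s\<close> to the sorted list of the image.\<close>

lemma strict_mono_on_image_unique:
  fixes f g :: "nat \<Rightarrow> nat"
  assumes "finite s" "strict_mono_on s f" "strict_mono_on s g" "f ` s = g ` s" "x \<in> s"
  shows "f x = g x"
proof -
  let ?l = "sorted_list_of_set s"
  have "sorted_wrt (<) (map h ?l)" if "strict_mono_on s h" for h :: "nat \<Rightarrow> nat"
    unfolding sorted_wrt_map
    by (rule sorted_wrt_mono_rel[OF _ strict_sorted_list_of_set])
      (use that assms(1) in \<open>auto simp: strict_mono_on_def\<close>)
  then have "map f ?l = map g ?l"
    using assms by (intro strict_sorted_equal) auto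
  then show ?thesis using assms(1,5) by (simp add: map_eq_conv)
qed

lemma diagram_eqI:
  assumes d: "d \<in> carrier (planar_rook n)" "d' \<in> carrier (planar_rook n)"
    and eq: "dom d = dom d'" "(the \<circ> d) ` dom d = (the \<circ> d') ` dom d"
  shows "d = d'"
proof
  fix x
  have fin: "finite (dom d)" using d(1) by (auto simp: carrier_planar_rook intro: finite_subset)
  show "d x = d' x"
  proof (cases "x \<in> dom d")
    case True
    then have "(the \<circ> d) x = (the \<circ> d') x"
      using d eq by (intro strict_mono_on_image_unique[OF fin, where f = "the \<circ> d" and g = "the \<circ> d'"])
        (simp_all only: carrier_planar_rook)
    moreover have "x \<in> dom d'" using True eq(1) by simp
    ultimately show ?thesis using True by (auto simp: dom_def)
  next
    case False
    then show ?thesis using eq(1) by (auto simp: domIff)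
  qed
qed

text \<open>Both \<open>s\<close> and \<open>r\<close> are order isomorphic to an initial segment of the natural numbers.\<close>

lemma diagram_exists:
  assumes "s \<subseteq> {1..n}" "r \<subseteq> {1..n}" "card r = card s"
  obtains d where "d \<in> carrier (planar_rook n)" "dom d = s" "(the \<circ> d) ` s = r"
proof -
  have fin: "finite s" "finite r" using assms finite_subset by blast+
  obtain f where f: "bij_betw f {..<card s} s" "strict_mono_on {..<card s} f"
    using ex_bij_betw_strict_mono_card[OF fin(1)] .
  obtain g where g: "bij_betw g {..<card s} r" "strict_mono_on {..<card s} g"
    using ex_bij_betw_strict_mono_card[OF fin(2)] assms(3) by metis
  let ?h = "g \<circ> the_inv_into {..<card s} f"
  have inv: "bij_betw (the_inv_into {..<card s} f) s {..<card s}"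
    by (rule bij_betw_the_inv_into[OF f(1)])
  have "strict_mono_on s (the_inv_into {..<card s} f)"
  proof (rule strict_mono_onI)
    fix x y assume xy: "x \<in> s" "y \<in> s" "x < y"
    let ?i = "the_inv_into {..<card s} f"
    have fx: "f (?i x) = x" "f (?i y) = y"
      using f(1) xy by (auto simp: bij_betw_def intro: f_the_inv_into_f)
    have "?i x \<in> {..<card s}" "?i y \<in> {..<card s}" using bij_betwE[OF inv] xy by auto
    then show "?i x < ?i y"
      using f(2) fx xy(3) by (metis strict_mono_onD linorder_neqE less_asym)
  qed
  then have mono: "strict_mono_on s ?h"
    using g(2) bij_betwE[OF inv] by (auto simp: strict_mono_on_def)
  have im: "?h ` s = r"
    using inv g(1) unfolding bij_betw_def image_comp[symmetric] by simp
  define d where "d = (\<lambda>x. if x \<in> s then Some (?h x) else None)"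
  have dom: "dom d = s" by (auto simp: d_def split: if_splits)
  have th: "x \<in> s \<Longrightarrow> (the \<circ> d) x = ?h x" for x by (simp add: d_def)
  have img: "(the \<circ> d) ` s = r" using im th by (simp cong: image_cong)
  have "ran d \<subseteq> r" using im by (auto simp: d_def ran_def split: if_splits)
  moreover have "strict_mono_on s (the \<circ> d)" using mono th by (simp add: strict_mono_on_def)
  ultimately have "d \<in> carrier (planar_rook n)"
    using assms dom by (auto simp: carrier_planar_rook)
  then show ?thesis using that dom img by blast
qed

lemma planar_rook_mult_closed:
  assumes "p \<in> carrier (planar_rook n)" "q \<in> carrier (planar_rook n)"
  shows "p \<otimes>\<^bsub>planar_rook n\<^esub> q \<in> carrier (planar_rook n)"
proof -
  have m: "p \<otimes>\<^bsub>planar_rook n\<^esub> q = p \<circ>\<^sub>m q" by (simp add: planar_rook_def)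
  have sub: "dom (p \<circ>\<^sub>m q) \<subseteq> dom q" "ran (p \<circ>\<^sub>m q) \<subseteq> ran p"
    by (auto simp: map_comp_def ran_def split: option.splits)
  have val: "x \<in> dom q" "the (q x) \<in> dom p" "(the \<circ> (p \<circ>\<^sub>m q)) x = (the \<circ> p) ((the \<circ> q) x)"
    if "x \<in> dom (p \<circ>\<^sub>m q)" for x
    using that by (auto simp: map_comp_def split: option.splits)
  have "strict_mono_on (dom (p \<circ>\<^sub>m q)) (the \<circ> (p \<circ>\<^sub>m q))"
    using assms val unfolding carrier_planar_rook strict_mono_on_def by (metis comp_apply)
  then show ?thesis using assms sub unfolding m carrier_planar_rook by blast
qed

lemma carrier_planar_rook_algebra:
  "a \<in> carrier (planar_rook_algebra n) \<longleftrightarrow> (\<forall>d. d \<notin> carrier (planar_rook n) \<longrightarrow> a d = 0)"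
proof
  assume "\<forall>d. d \<notin> carrier (planar_rook n) \<longrightarrow> a d = 0"
  then have "support a \<subseteq> carrier (planar_rook n)" by (auto simp: support_def)
  then show "a \<in> carrier (planar_rook_algebra n)"
    using finite_subset[OF _ finite_planar_rook[of n]] by (simp add: monoid_algebra_def)
qed (auto simp: monoid_algebra_def support_def)

text \<open>The matrix of an element of the planar rook algebra with respect to the \<open>v\<^sub>s\<close>: the entry in row \<open>r\<close>
  and column \<open>s\<close> collects the diagrams that send \<open>s\<close> to \<open>r\<close>.\<close>

definition diagram_matrix :: "nat \<Rightarrow> ((nat \<rightharpoonup> nat) \<Rightarrow> complex) \<Rightarrow> nat set \<Rightarrow> nat set \<Rightarrow> complex" where
  "diagram_matrix n a r s = (\<Sum>d | d \<in> carrier (planar_rook n) \<and> s \<subseteq> dom d \<and> (the \<circ> d) ` s = r. a d)"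

lemma diagram_matrix_card: "diagram_matrix n a r s \<noteq> 0 \<Longrightarrow> card r = card s"
  unfolding diagram_matrix_def
  by (erule sum.not_neutral_contains_not_neutral) (use card_diagram_image in fastforce)

lemma diagram_matrix_diff:
  "diagram_matrix n (a - b) r s = diagram_matrix n a r s - diagram_matrix n b r s"
  by (simp add: diagram_matrix_def sum_subtractf)

lemma diagram_matrix_sum:
  "diagram_matrix n (\<lambda>d. \<Sum>i\<in>I. c i * b i d) r s = (\<Sum>i\<in>I. c i * diagram_matrix n (b i) r s)"
  unfolding diagram_matrix_def sum_distrib_left by (rule sum.swap)

text \<open>Take a diagram \<open>d\<close> in the support of \<open>a\<close> with as many edges as possible.  Any other
  diagram that sends the set \<open>dom d\<close> onto \<open>ran d\<close> has more edges, because domain and range determine a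
  diagram; so the entry in row \<open>ran d\<close> and column \<open>dom d\<close> is the coefficient of \<open>d\<close>.\<close>

lemma diagram_matrix_eq_0_imp:
  assumes a: "a \<in> carrier (planar_rook_algebra n)"
    and z: "\<And>r s. r \<subseteq> {1..n} \<Longrightarrow> s \<subseteq> {1..n} \<Longrightarrow> diagram_matrix n a r s = 0"
  shows "a = 0"
proof (rule ccontr)
  assume "a \<noteq> 0"
  then obtain d0 where "a d0 \<noteq> 0" by (auto simp: fun_eq_iff)
  then have ne: "support a \<noteq> {}" by (auto simp: support_def)
  have supp: "support a \<subseteq> carrier (planar_rook n)"
    using a by (auto simp: carrier_planar_rook_algebra support_def)
  then have fin: "finite (support a)" using finite_planar_rook finite_subset by blast
  obtain d where d: "d \<in> support a" and max: "card (dom d) = Max ((\<lambda>d. card (dom d)) ` support a)"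
    using Max_in[of "(\<lambda>d. card (dom d)) ` support a"] fin ne by fastforce
  have dP: "d \<in> carrier (planar_rook n)" using d supp by blast
  let ?S = "{d'. d' \<in> carrier (planar_rook n) \<and> dom d \<subseteq> dom d' \<and> (the \<circ> d') ` dom d = (the \<circ> d) ` dom d}"
  have "a d' = 0" if d': "d' \<in> ?S - {d}" for d'
  proof (rule ccontr)
    assume "a d' \<noteq> 0"
    then have "card (dom d') \<le> card (dom d)" unfolding max using fin by (simp add: support_def)
    moreover have "finite (dom d')" using d' by (auto simp: carrier_planar_rook intro: finite_subset)
    ultimately have "dom d = dom d'" using d' card_seteq[of "dom d'" "dom d"] by auto
    then have "d = d'" using d' by (intro diagram_eqI[OF dP]) auto
    then show False using d' by simp
  qed
  then have "diagram_matrix n a ((the \<circ> d) ` dom d) (dom d) = sum a {d}"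
    unfolding diagram_matrix_def using dP finite_planar_rook[of n]
    by (intro sum.mono_neutral_right) auto
  moreover have "(the \<circ> d) ` dom d \<subseteq> {1..n}" "dom d \<subseteq> {1..n}"
    using dP diagram_image_subset by (auto simp: carrier_planar_rook)
  ultimately show False using z d by (simp add: support_def)
qed

text \<open>The diagram from \<open>s0\<close> onto \<open>r0\<close> has the matrix unit asked for as its leading term; the other terms
  have a proper subset of \<open>s0\<close> as column index and are subtracted by induction.\<close>

lemma diagram_matrix_unit:
  assumes "finite s0" "s0 \<subseteq> {1..n}" "r0 \<subseteq> {1..n}" "card r0 = card s0"
  shows "\<exists>a\<in>carrier (planar_rook_algebra n). \<forall>r s. diagram_matrix n a r s = (if r = r0 \<and> s = s0 then 1 else 0)"
  using assms
proof (induct s0 arbitrary: r0 rule: finite_psubset_induct)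
  case (psubset s0)
  obtain d where d: "d \<in> carrier (planar_rook n)" "dom d = s0" "(the \<circ> d) ` s0 = r0"
    using diagram_exists psubset.prems by metis
  let ?d = "\<lambda>s. (the \<circ> d) ` s" and ?S = "Pow s0 - {s0}"
  have "\<exists>a\<in>carrier (planar_rook_algebra n). \<forall>r s. diagram_matrix n a r s = (if r = ?d s' \<and> s = s' then 1 else 0)"
    if "s' \<in> ?S" for s'
  proof (rule psubset.hyps(2))
    show "s' \<subset> s0" using that by auto
    show "s' \<subseteq> {1..n}" using that psubset.prems by auto
    show "?d s' \<subseteq> {1..n}" "card (?d s') = card s'"
      using that d diagram_image_subset card_diagram_image by auto
  qed
  then obtain b where b: "\<And>s'. s' \<in> ?S \<Longrightarrow> b s' \<in> carrier (planar_rook_algebra n)"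
    "\<And>s' r s. s' \<in> ?S \<Longrightarrow> diagram_matrix n (b s') r s = (if r = ?d s' \<and> s = s' then 1 else 0)"
    by metis
  \<comment> \<open>\<open>?u\<close> is the diagram \<open>d\<close> as an element of the algebra, and \<open>?b\<close> collects the lower terms of its
    matrix; the factor \<open>1\<close> gives \<open>?b\<close> the shape of a linear combination\<close>
  let ?u = "\<lambda>d'. if d' = d then 1 else 0 :: complex"
  let ?b = "\<lambda>d'. \<Sum>s'\<in>?S. 1 * b s' d'"
  have u: "diagram_matrix n ?u r s = (if s \<subseteq> s0 \<and> ?d s = r then 1 else 0)" for r s
    using d finite_planar_rook[of n] by (auto simp: diagram_matrix_def sum.delta)
  have fin: "finite ?S" using psubset.hyps(1) by simp
  have bm: "diagram_matrix n ?b r s = (if s \<in> ?S \<and> ?d s = r then 1 else 0)" for r s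
  proof -
    have "diagram_matrix n ?b r s = (\<Sum>s'\<in>?S. if s' = s then (if ?d s = r then 1 else 0) else 0)"
      unfolding diagram_matrix_sum by (rule sum.cong) (auto simp: b(2))
    then show ?thesis using fin by (simp add: sum.delta)
  qed
  show ?case
  proof (intro bexI allI)
    show "?u - ?b \<in> carrier (planar_rook_algebra n)"
      using b(1) d(1) by (auto simp: carrier_planar_rook_algebra)
    show "diagram_matrix n (?u - ?b) r s = (if r = r0 \<and> s = s0 then 1 else 0)" for r s
      unfolding diagram_matrix_diff u bm using d(3) by auto
  qed
qed

lemma diagram_matrix_surj:
  assumes M: "\<And>r s. r \<subseteq> {1..n} \<Longrightarrow> s \<subseteq> {1..n} \<Longrightarrow> M r s \<noteq> 0 \<Longrightarrow> card r = card s"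
  shows "\<exists>a\<in>carrier (planar_rook_algebra n).
    \<forall>r s. r \<subseteq> {1..n} \<longrightarrow> s \<subseteq> {1..n} \<longrightarrow> diagram_matrix n a r s = M r s"
proof -
  let ?I = "{x \<in> Pow {1..n} \<times> Pow {1..n}. card (fst x) = card (snd x)}"
  have "\<exists>a\<in>carrier (planar_rook_algebra n). \<forall>r s. diagram_matrix n a r s = (if r = fst x \<and> s = snd x then 1 else 0)"
    if "x \<in> ?I" for x
    using that finite_subset[of "snd x" "{1..n}"] by (intro diagram_matrix_unit) auto
  then have "\<forall>x\<in>?I. \<exists>a. a \<in> carrier (planar_rook_algebra n) \<and>
      (\<forall>r s. diagram_matrix n a r s = (if r = fst x \<and> s = snd x then 1 else 0))"
    unfolding Bex_def by (rule ballI)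
  from bchoice[OF this] obtain b where "\<forall>x\<in>?I. b x \<in> carrier (planar_rook_algebra n) \<and>
      (\<forall>r s. diagram_matrix n (b x) r s = (if r = fst x \<and> s = snd x then 1 else 0))" ..
  then have b: "\<And>x. x \<in> ?I \<Longrightarrow> b x \<in> carrier (planar_rook_algebra n)"
    "\<And>x r s. x \<in> ?I \<Longrightarrow> diagram_matrix n (b x) r s = (if r = fst x \<and> s = snd x then 1 else 0)"
    by (simp_all only:)
  let ?a = "\<lambda>d. \<Sum>x\<in>?I. M (fst x) (snd x) * b x d"
  have fin: "finite ?I" by simp
  show ?thesis
  proof (intro bexI allI impI)
    show "?a \<in> carrier (planar_rook_algebra n)"
      using b(1) by (auto simp: carrier_planar_rook_algebra intro!: sum.neutral)
    fix r s assume rs: "r \<subseteq> {1..n}" "s \<subseteq> {1..n}"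
    have "diagram_matrix n ?a r s = (\<Sum>x\<in>?I. if x = (r, s) then M r s else 0)"
      unfolding diagram_matrix_sum by (rule sum.cong) (auto simp: b(2))
    also have "\<dots> = (if (r, s) \<in> ?I then M r s else 0)" using fin by (rule sum.delta)
    also have "\<dots> = M r s" using M rs by auto
    finally show "diagram_matrix n ?a r s = M r s" .
  qed
qed


section \<open>The representation of the planar rook algebra\<close>

lemma v_diagram_closed: "v_diagram (Suc n) d s \<in> tensor_power (Suc n)"
  by (simp add: v_diagram_def v_vec_closed)

lemma End_algebra_eqI:
  assumes S: "S \<in> carrier (End_algebra (Suc n))" and T: "T \<in> carrier (End_algebra (Suc n))"
    and v: "\<And>s. s \<subseteq> {1..n} \<Longrightarrow> S (v_vec (Suc n) s) = T (v_vec (Suc n) s)"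
    and fv: "\<And>s. s \<subseteq> {1..n} \<Longrightarrow> S (lower (Suc n) (v_vec (Suc n) s)) = T (lower (Suc n) (v_vec (Suc n) s))"
  shows "S = T"
proof (rule extensionalityI[of _ "tensor_power (Suc n)"])
  fix t :: tensor assume t: "t \<in> tensor_power (Suc n)"
  show "S t = T t"
    using S T by (intro tensor_linear_eqI[OF _ _ v fv t]) (simp_all add: carrier_End_algebra)
qed (use S T in \<open>simp_all add: carrier_End_algebra\<close>)

definition diagram_op :: "nat \<Rightarrow> (nat \<rightharpoonup> nat) \<Rightarrow> tensor \<Rightarrow> tensor" where
  "diagram_op n d = basis_ext n (v_diagram (Suc n) d)"

lemma diagram_op_End: "diagram_op n d \<in> carrier (End_algebra (Suc n))"
  and diagram_op_v: "s \<subseteq> {1..n} \<Longrightarrow> diagram_op n d (v_vec (Suc n) s) = v_diagram (Suc n) d s"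
  and diagram_op_fv: "s \<subseteq> {1..n} \<Longrightarrow>
    diagram_op n d (lower (Suc n) (v_vec (Suc n) s)) = lower (Suc n) (v_diagram (Suc n) d s)"
  unfolding diagram_op_def using basis_ext[of n "v_diagram (Suc n) d"] v_diagram_closed by blast+

lemma diagram_op_linear: "tensor_linear (Suc n) (diagram_op n d)"
  using diagram_op_End by (simp add: carrier_End_algebra)

text \<open>The two families of values prescribed for a diagram operator are compatible with \<open>f\<close> and live on a
  basis, hence they describe exactly one operator.\<close>

lemma diagram_operator_iff: "diagram_operator (Suc n) d T \<longleftrightarrow> T = diagram_op n d"
proof
  assume "diagram_operator (Suc n) d T"
  then show "T = diagram_op n d"
    by (intro End_algebra_eqI[of _ n])
      (simp_all add: diagram_operator_def lower_def[symmetric] diagram_op_End diagram_op_v diagram_op_fv)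
qed (simp add: diagram_operator_def lower_def[symmetric] diagram_op_End diagram_op_v diagram_op_fv)

lemma rook_action_support:
  "t \<in> tensor_power (Suc n) \<Longrightarrow>
     rook_action (Suc n) a t = (\<Sum>d\<in>support a. tscale (a d) (diagram_op n d t))"
  by (simp add: rook_action_def diagram_operator_iff)

lemma rook_action_eq:
  assumes a: "a \<in> carrier (planar_rook_algebra n)" and t: "t \<in> tensor_power (Suc n)"
  shows "rook_action (Suc n) a t = (\<Sum>d\<in>carrier (planar_rook n). tscale (a d) (diagram_op n d t))"
  unfolding rook_action_support[OF t]
  by (rule sum.mono_neutral_left)
    (use a finite_planar_rook in \<open>auto simp: support_def carrier_planar_rook_algebra\<close>)

lemma rook_action_End: "rook_action (Suc n) a \<in> carrier (End_algebra (Suc n))"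
proof -
  note X = diagram_op_linear[of n]
  have "rook_action (Suc n) a t \<in> tensor_power (Suc n)" if t: "t \<in> tensor_power (Suc n)" for t
    unfolding rook_action_support[OF t]
    by (intro tensor_power_sum tensor_power_tscale tensor_linear_closed[OF X] t)
  moreover have "rook_action (Suc n) a (t + u) = rook_action (Suc n) a t + rook_action (Suc n) a u"
    if t: "t \<in> tensor_power (Suc n)" and u: "u \<in> tensor_power (Suc n)" for t u
    unfolding rook_action_support[OF t] rook_action_support[OF u] rook_action_support[OF tensor_power_add[OF t u]]
      tensor_linear_add[OF X t u]
    by (simp add: fun_eq_iff sum_tensor_apply tscale_def sum.distrib algebra_simps)
  moreover have "rook_action (Suc n) a (tscale c t) = tscale c (rook_action (Suc n) a t)"
    if t: "t \<in> tensor_power (Suc n)" for c t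
    unfolding rook_action_support[OF t] rook_action_support[OF tensor_power_tscale[OF t]]
      tensor_linear_tscale[OF X t]
    by (simp add: fun_eq_iff sum_tensor_apply tscale_def sum_distrib_left algebra_simps)
  moreover have "rook_action (Suc n) a \<in> extensional (tensor_power (Suc n))"
    by (simp add: rook_action_def)
  ultimately show ?thesis
    by (auto simp: carrier_End_algebra tensor_linear_def)
qed

text \<open>Grouping the diagrams \<open>d\<close> with \<open>s \<subseteq> dom d\<close> by the image of \<open>s\<close>.\<close>

lemma rook_action_v:
  assumes a: "a \<in> carrier (planar_rook_algebra n)" and s: "s \<subseteq> {1..n}"
  shows "rook_action (Suc n) a (v_vec (Suc n) s) =
    (\<Sum>r\<in>Pow {1..n}. tscale (diagram_matrix n a r s) (v_vec (Suc n) r))"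
proof
  fix w
  let ?P = "{d \<in> carrier (planar_rook n). s \<subseteq> dom d}"
  have fin: "finite ?P" using finite_planar_rook[of n] by simp
  have "rook_action (Suc n) a (v_vec (Suc n) s) w =
      (\<Sum>d\<in>carrier (planar_rook n). a d * v_diagram (Suc n) d s w)"
    unfolding rook_action_eq[OF a v_vec_closed] diagram_op_v[OF s]
    by (simp add: sum_tensor_apply tscale_def)
  also have "\<dots> = (\<Sum>d\<in>?P. a d * v_vec (Suc n) ((the \<circ> d) ` s) w)"
    using finite_planar_rook[of n]
    by (intro sum.mono_neutral_cong_right) (auto simp: v_diagram_def)
  also have "\<dots> = (\<Sum>r\<in>Pow {1..n}. \<Sum>d | d \<in> ?P \<and> (the \<circ> d) ` s = r. a d * v_vec (Suc n) ((the \<circ> d) ` s) w)"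
    by (rule sum.group[symmetric, OF fin])
      (simp, rule image_subsetI, rule PowI, rule diagram_image_subset, simp_all)
  also have "\<dots> = (\<Sum>r\<in>Pow {1..n}. diagram_matrix n a r s * v_vec (Suc n) r w)"
    unfolding diagram_matrix_def sum_distrib_right
    by (intro sum.cong) auto
  finally show "rook_action (Suc n) a (v_vec (Suc n) s) w =
      (\<Sum>r\<in>Pow {1..n}. tscale (diagram_matrix n a r s) (v_vec (Suc n) r)) w"
    by (simp add: sum_tensor_apply tscale_def)
qed

lemma rook_action_fv:
  assumes s: "s \<subseteq> {1..n}"
  shows "rook_action (Suc n) a (lower (Suc n) (v_vec (Suc n) s)) =
    lower (Suc n) (rook_action (Suc n) a (v_vec (Suc n) s))"
proof -
  have "lower (Suc n) (\<Sum>d\<in>support a. tscale (a d) (v_diagram (Suc n) d s)) =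
      (\<Sum>d\<in>support a. lower (Suc n) (tscale (a d) (v_diagram (Suc n) d s)))"
    by (rule tensor_linear_sum[OF tensor_linear_lower]) (rule tensor_power_tscale[OF v_diagram_closed])
  then show ?thesis
    unfolding rook_action_support[OF v_vec_closed] rook_action_support[OF lower_closed[OF v_vec_closed]]
      diagram_op_v[OF s] diagram_op_fv[OF s] lower_linear by (rule sym)
qed

text \<open>The matrix can be recovered from the operator, which transfers injectivity from matrices.\<close>

lemma rook_action_coordinate:
  assumes a: "a \<in> carrier (planar_rook_algebra n)" and s: "s \<subseteq> {1..n}" and r: "r \<subseteq> {1..n}"
  shows "rook_action (Suc n) a (v_vec (Suc n) s) (1 # subset_word n r) = diagram_matrix n a r s"
proof -
  have "rook_action (Suc n) a (v_vec (Suc n) s) (1 # subset_word n r) =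
      (\<Sum>q\<in>Pow {1..n}. if q = r then diagram_matrix n a r s else 0)"
    unfolding rook_action_v[OF a s] sum_tensor_apply tscale_def
    by (rule sum.cong) (use r in \<open>auto simp: v_vec_coordinate\<close>)
  then show ?thesis using r by (simp add: sum.delta)
qed

text \<open>On basis vectors both sides send \<open>v\<^sub>s\<close> to \<open>v\<^bsub>p (q s)\<^esub>\<close> when \<open>s \<subseteq> dom q\<close> and \<open>q s \<subseteq> dom p\<close>, which is
  the condition \<open>s \<subseteq> dom (p q)\<close>, and to zero otherwise.\<close>

lemma diagram_op_mult:
  assumes q: "q \<in> carrier (planar_rook n)" and t: "t \<in> tensor_power (Suc n)"
  shows "diagram_op n (p \<otimes>\<^bsub>planar_rook n\<^esub> q) t = diagram_op n p (diagram_op n q t)"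
proof (rule tensor_linear_eqI[OF diagram_op_linear tensor_linear_comp[OF diagram_op_linear diagram_op_linear] _ _ t])
  fix s assume s: "s \<subseteq> {1..n}"
  have m: "p \<otimes>\<^bsub>planar_rook n\<^esub> q = p \<circ>\<^sub>m q" by (simp add: planar_rook_def)
  have dom: "s \<subseteq> dom (p \<circ>\<^sub>m q) \<longleftrightarrow> s \<subseteq> dom q \<and> (the \<circ> q) ` s \<subseteq> dom p"
  proof -
    have "x \<in> dom (p \<circ>\<^sub>m q) \<longleftrightarrow> x \<in> dom q \<and> (the \<circ> q) x \<in> dom p" for x
      by (auto simp: map_comp_def split: option.splits)
    then show ?thesis by blast
  qed
  have im: "(the \<circ> (p \<circ>\<^sub>m q)) ` s = (the \<circ> p) ` (the \<circ> q) ` s" if "s \<subseteq> dom q"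
    unfolding image_comp by (rule image_cong) (use that in \<open>auto simp: map_comp_def\<close>)
  let ?q = "(the \<circ> q) ` s"
  have sub: "?q \<subseteq> {1..n}" if "s \<subseteq> dom q" using diagram_image_subset[OF q that] .
  note z = tensor_linear_0[OF diagram_op_linear]
  have v: "v_diagram (Suc n) (p \<circ>\<^sub>m q) s = (if s \<subseteq> dom q then v_diagram (Suc n) p ?q else 0)"
    using im by (simp add: v_diagram_def dom)
  have q_op: "v_diagram (Suc n) q s = (if s \<subseteq> dom q then v_vec (Suc n) ?q else 0)"
    by (simp add: v_diagram_def)
  show "diagram_op n (p \<otimes>\<^bsub>planar_rook n\<^esub> q) (v_vec (Suc n) s) = diagram_op n p (diagram_op n q (v_vec (Suc n) s))"
    unfolding m diagram_op_v[OF s] v q_op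
    by (cases "s \<subseteq> dom q") (simp_all only: if_True if_False z diagram_op_v[OF sub])
  show "diagram_op n (p \<otimes>\<^bsub>planar_rook n\<^esub> q) (lower (Suc n) (v_vec (Suc n) s)) =
      diagram_op n p (diagram_op n q (lower (Suc n) (v_vec (Suc n) s)))"
    unfolding m diagram_op_fv[OF s] v q_op
    by (cases "s \<subseteq> dom q") (simp_all only: if_True if_False z lower_linear diagram_op_fv[OF sub])
qed

text \<open>The universal property of the monoid algebra in scalar form: a linear functional evaluated on a
  product is the bilinear expansion of its values on products of monoid elements.\<close>

lemma monoid_algebra_mult_sum:
  assumes "finite (support a)" "finite (support b)" "finite S"
    and "\<And>p q. p \<in> support a \<Longrightarrow> q \<in> support b \<Longrightarrow> p \<otimes>\<^bsub>G\<^esub> q \<in> S"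
  shows "(\<Sum>g\<in>S. (a \<otimes>\<^bsub>monoid_algebra G\<^esub> b) g * \<phi> g) =
    (\<Sum>p\<in>support a. \<Sum>q\<in>support b. a p * b q * \<phi> (p \<otimes>\<^bsub>G\<^esub> q))"
proof -
  let ?P = "support a \<times> support b"
  have fin: "finite ?P" using assms by simp
  have "(a \<otimes>\<^bsub>monoid_algebra G\<^esub> b) g =
      (\<Sum>x\<in>?P. if fst x \<otimes>\<^bsub>G\<^esub> snd x = g then a (fst x) * b (snd x) else 0)" for g
    unfolding sum.inter_filter[OF fin, symmetric]
    by (auto simp: monoid_algebra_def case_prod_unfold intro!: sum.cong)
  then have "(\<Sum>g\<in>S. (a \<otimes>\<^bsub>monoid_algebra G\<^esub> b) g * \<phi> g) =
      (\<Sum>g\<in>S. \<Sum>x\<in>?P. if g = fst x \<otimes>\<^bsub>G\<^esub> snd x then a (fst x) * b (snd x) * \<phi> g else 0)"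
    by (auto simp: sum_distrib_right intro!: sum.cong)
  also have "\<dots> = (\<Sum>x\<in>?P. \<Sum>g\<in>S. if g = fst x \<otimes>\<^bsub>G\<^esub> snd x then a (fst x) * b (snd x) * \<phi> g else 0)"
    by (rule sum.swap)
  also have "\<dots> = (\<Sum>x\<in>?P. a (fst x) * b (snd x) * \<phi> (fst x \<otimes>\<^bsub>G\<^esub> snd x))"
    using assms by (intro sum.cong) (auto simp: sum.delta)
  also have "\<dots> = (\<Sum>p\<in>support a. \<Sum>q\<in>support b. a p * b q * \<phi> (p \<otimes>\<^bsub>G\<^esub> q))"
    by (simp add: sum.cartesian_product case_prod_unfold)
  finally show ?thesis .
qed

lemma rook_action_mult:
  assumes a: "a \<in> carrier (planar_rook_algebra n)" and b: "b \<in> carrier (planar_rook_algebra n)"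
    and ab: "a \<otimes>\<^bsub>planar_rook_algebra n\<^esub> b \<in> carrier (planar_rook_algebra n)"
    and t: "t \<in> tensor_power (Suc n)"
  shows "rook_action (Suc n) (a \<otimes>\<^bsub>planar_rook_algebra n\<^esub> b) t =
    rook_action (Suc n) a (rook_action (Suc n) b t)"
proof
  fix w
  have supp: "finite (support c)" "support c \<subseteq> carrier (planar_rook n)"
    if "c \<in> carrier (planar_rook_algebra n)" for c
    using that by (auto simp: monoid_algebra_def)
  note X = diagram_op_linear[of n]
  have "rook_action (Suc n) (a \<otimes>\<^bsub>planar_rook_algebra n\<^esub> b) t w =
      (\<Sum>g\<in>carrier (planar_rook n). (a \<otimes>\<^bsub>planar_rook_algebra n\<^esub> b) g * diagram_op n g t w)"
    unfolding rook_action_eq[OF ab t] by (simp add: sum_tensor_apply tscale_def)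
  also have "\<dots> = (\<Sum>p\<in>support a. \<Sum>q\<in>support b. a p * b q * diagram_op n (p \<otimes>\<^bsub>planar_rook n\<^esub> q) t w)"
    using supp[OF a] supp[OF b]
    by (intro monoid_algebra_mult_sum finite_planar_rook planar_rook_mult_closed) auto
  also have "\<dots> = (\<Sum>p\<in>support a. a p * (\<Sum>q\<in>support b. b q * diagram_op n p (diagram_op n q t) w))"
    unfolding sum_distrib_left using supp[OF b]
    by (intro sum.cong refl) (auto simp: diagram_op_mult[OF _ t] mult.assoc)
  also have "\<dots> = (\<Sum>p\<in>support a. a p * diagram_op n p (rook_action (Suc n) b t) w)"
  proof -
    have "diagram_op n p (rook_action (Suc n) b t) =
        (\<Sum>q\<in>support b. tscale (b q) (diagram_op n p (diagram_op n q t)))" for p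
      unfolding rook_action_support[OF t]
      by (subst tensor_linear_sum[OF X])
        (simp_all add: tensor_linear_tscale[OF X] tensor_linear_closed[OF X] tensor_power_tscale t)
    then show ?thesis by (simp add: sum_tensor_apply tscale_def)
  qed
  also have "\<dots> = rook_action (Suc n) a (rook_action (Suc n) b t) w"
  proof -
    have "rook_action (Suc n) b t \<in> tensor_power (Suc n)"
      using rook_action_End t by (auto simp: carrier_End_algebra intro: tensor_linear_closed)
    then show ?thesis by (simp add: rook_action_support sum_tensor_apply tscale_def)
  qed
  finally show "rook_action (Suc n) (a \<otimes>\<^bsub>planar_rook_algebra n\<^esub> b) t w =
      rook_action (Suc n) a (rook_action (Suc n) b t) w" .
qed

lemma planar_rook_algebra_mult_closed:
  assumes "a \<in> carrier (planar_rook_algebra n)" "b \<in> carrier (planar_rook_algebra n)"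
  shows "a \<otimes>\<^bsub>planar_rook_algebra n\<^esub> b \<in> carrier (planar_rook_algebra n)"
proof -
  have "(a \<otimes>\<^bsub>planar_rook_algebra n\<^esub> b) g = 0" if g: "g \<notin> carrier (planar_rook n)" for g
  proof -
    have "{(p, q) \<in> support a \<times> support b. p \<otimes>\<^bsub>planar_rook n\<^esub> q = g} = {}" (is "?S = {}")
      using assms g planar_rook_mult_closed[of _ n] unfolding monoid_algebra_def by fastforce
    moreover have "(a \<otimes>\<^bsub>planar_rook_algebra n\<^esub> b) g = (\<Sum>(p, q)\<in>?S. a p * b q)"
      by (simp add: monoid_algebra_def)
    ultimately show ?thesis by (simp only: sum.empty)
  qed
  then show ?thesis by (simp add: carrier_planar_rook_algebra)
qed

lemma diagram_op_one:
  assumes t: "t \<in> tensor_power (Suc n)"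
  shows "diagram_op n \<one>\<^bsub>planar_rook n\<^esub> t = t"
proof (rule tensor_linear_eqI[OF diagram_op_linear _ _ _ t])
  show "tensor_linear (Suc n) (\<lambda>t. t)" by (auto simp: tensor_linear_def)
  fix s assume s: "s \<subseteq> {1..n}"
  have "(the \<circ> (Some |` {1..n})) ` s = id ` s"
    by (rule image_cong) (use s in auto)
  then have "v_diagram (Suc n) \<one>\<^bsub>planar_rook n\<^esub> s = v_vec (Suc n) s"
    using s by (simp add: planar_rook_def v_diagram_def)
  then show "diagram_op n \<one>\<^bsub>planar_rook n\<^esub> (v_vec (Suc n) s) = v_vec (Suc n) s"
    "diagram_op n \<one>\<^bsub>planar_rook n\<^esub> (lower (Suc n) (v_vec (Suc n) s)) = lower (Suc n) (v_vec (Suc n) s)"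
    by (simp_all only: diagram_op_v[OF s] diagram_op_fv[OF s])
qed

lemma rook_action_algebra_hom:
  "rook_action (Suc n) \<in> algebra_hom (planar_rook_algebra n) (End_algebra (Suc n))"
proof -
  let ?A = "planar_rook_algebra n" and ?E = "End_algebra (Suc n)" and ?V = "tensor_power (Suc n)"
  have ext: "rook_action (Suc n) a = (\<lambda>t\<in>?V. X t)"
    if "\<And>t. t \<in> ?V \<Longrightarrow> rook_action (Suc n) a t = X t" for a X
    using that by (auto simp: rook_action_def)
  have "rook_action (Suc n) (a \<otimes>\<^bsub>?A\<^esub> b) = rook_action (Suc n) a \<otimes>\<^bsub>?E\<^esub> rook_action (Suc n) b"
    if "a \<in> carrier ?A" "b \<in> carrier ?A" for a b
  proof -
    have "rook_action (Suc n) (a \<otimes>\<^bsub>?A\<^esub> b) = (\<lambda>t\<in>?V. rook_action (Suc n) a (rook_action (Suc n) b t))"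
      by (rule ext, rule rook_action_mult[OF that planar_rook_algebra_mult_closed[OF that]])
    then show ?thesis by (simp add: End_algebra_def compose_def)
  qed
  moreover have "rook_action (Suc n) (a \<oplus>\<^bsub>?A\<^esub> b) = rook_action (Suc n) a \<oplus>\<^bsub>?E\<^esub> rook_action (Suc n) b"
    if a: "a \<in> carrier ?A" and b: "b \<in> carrier ?A" for a b
  proof -
    have add: "a \<oplus>\<^bsub>?A\<^esub> b = a + b" by (simp add: monoid_algebra_def)
    have ab: "a + b \<in> carrier ?A" using a b by (simp add: carrier_planar_rook_algebra)
    have "rook_action (Suc n) (a \<oplus>\<^bsub>?A\<^esub> b) = (\<lambda>t\<in>?V. rook_action (Suc n) a t + rook_action (Suc n) b t)"
      unfolding add
      by (rule ext) (simp add: rook_action_eq a b ab fun_eq_iff sum_tensor_apply tscale_def sum.distrib algebra_simps)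
    then show ?thesis by (simp add: End_algebra_def)
  qed
  moreover have "rook_action (Suc n) (c \<odot>\<^bsub>?A\<^esub> a) = c \<odot>\<^bsub>?E\<^esub> rook_action (Suc n) a"
    if a: "a \<in> carrier ?A" for a c
  proof -
    have sm: "c \<odot>\<^bsub>?A\<^esub> a = (\<lambda>d. c * a d)" by (simp add: monoid_algebra_def)
    have ca: "(\<lambda>d. c * a d) \<in> carrier ?A" using a by (simp add: carrier_planar_rook_algebra)
    have "rook_action (Suc n) (c \<odot>\<^bsub>?A\<^esub> a) = (\<lambda>t\<in>?V. tscale c (rook_action (Suc n) a t))"
      unfolding sm
      by (rule ext) (simp add: rook_action_eq a ca fun_eq_iff sum_tensor_apply tscale_def sum_distrib_left algebra_simps)
    then show ?thesis by (simp add: End_algebra_def)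
  qed
  moreover have "rook_action (Suc n) \<one>\<^bsub>?A\<^esub> = \<one>\<^bsub>?E\<^esub>"
  proof -
    have one: "\<one>\<^bsub>?A\<^esub> = (\<lambda>d. if d = \<one>\<^bsub>planar_rook n\<^esub> then 1 else 0)" by (simp add: monoid_algebra_def)
    have "support \<one>\<^bsub>?A\<^esub> = {\<one>\<^bsub>planar_rook n\<^esub>}" by (auto simp: one support_def)
    then have "rook_action (Suc n) \<one>\<^bsub>?A\<^esub> = (\<lambda>t\<in>?V. t)"
      by (intro ext) (simp add: rook_action_support diagram_op_one one)
    then show ?thesis by (simp add: End_algebra_def)
  qed
  ultimately show ?thesis
    by (auto simp: algebra_hom_def ring_hom_def rook_action_End)
qed


section \<open>The centralizer of \<open>gl(1|1)\<close>\<close>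

lemma weight_lower_scaled:
  "weight t = tscale (of_nat (Suc m)) t \<Longrightarrow> weight (lower k t) = tscale (of_nat m) (lower k t)"
  by (simp add: weight_lower) (simp add: fun_eq_iff tscale_def algebra_simps)

lemma tensor_linear_weight: "tensor_linear k weight"
  by (auto simp: tensor_linear_def tensor_power_def weight_def algebra_simps tscale_def fun_eq_iff)

text \<open>Necessity is \<open>e v\<^sub>s = 0\<close> and the weight of \<open>v\<^sub>s\<close>.  For sufficiency it remains to compare both sides on the
  \<open>f v\<^sub>s\<close>, where \<open>e f + f e = k\<close> settles the commutation with \<open>e\<close>, the relation \<open>f\<^sup>2 = 0\<close> that with \<open>f\<close>, and
  \<open>[h\<^sub>1, f] = - f\<close> that with \<open>h\<^sub>1\<close>.\<close>

lemma End_gl_iff: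
  assumes T: "T \<in> carrier (End_algebra (Suc n))"
  shows "T \<in> carrier (End_gl_algebra (Suc n)) \<longleftrightarrow>
    (\<forall>s \<subseteq> {1..n}. raise (Suc n) (T (v_vec (Suc n) s)) = 0 \<and>
      weight (T (v_vec (Suc n) s)) = tscale (of_nat (Suc (card s))) (T (v_vec (Suc n) s)) \<and>
      T (lower (Suc n) (v_vec (Suc n) s)) = lower (Suc n) (T (v_vec (Suc n) s)))"
    (is "?L \<longleftrightarrow> ?R")
proof -
  let ?V = "tensor_power (Suc n)"
  have X: "tensor_linear (Suc n) T" using T by (simp add: carrier_End_algebra)
  have L: "?L \<longleftrightarrow> (\<forall>a. \<forall>t\<in>?V. T (gl_act (Suc n) a t) = gl_act (Suc n) a (T t))"
    using T by (simp add: End_gl_algebra_def)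
  show ?thesis
  proof
    assume ?L
    then have comm: "T (gl_act (Suc n) a t) = gl_act (Suc n) a (T t)" if "t \<in> ?V" for a t
      using that L by blast
    show ?R
    proof (intro allI impI conjI)
      fix s assume s: "s \<subseteq> {1..n}"
      let ?v = "v_vec (Suc n) s"
      show "raise (Suc n) (T ?v) = 0"
        using comm[OF v_vec_closed, of e_mat s] by (simp add: raise_def[symmetric] tensor_linear_0[OF X])
      show "T (lower (Suc n) ?v) = lower (Suc n) (T ?v)"
        using comm[OF v_vec_closed, of f_mat s] by (simp add: lower_def[symmetric])
      \<comment> \<open>the matrix \<open>h\<^sub>1\<close>\<close>
      let ?h = "(\<chi> i j. if i = 1 \<and> j = 1 then 1 else 0) :: gl11"
      have "gl_act (Suc n) ?h t = weight t" if "t \<in> ?V" for t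
        using gl_act_eq[OF that, of ?h] by simp
      then have "T (weight ?v) = weight (T ?v)"
        using comm[OF v_vec_closed, of ?h s] v_vec_closed tensor_linear_closed[OF X] by metis
      then show "weight (T ?v) = tscale (of_nat (Suc (card s))) (T ?v)"
        by (simp only: weight_v_vec[OF s] tensor_linear_tscale[OF X v_vec_closed])
    qed
  next
    assume R: ?R
    note lin = tensor_linear_comp[OF X] tensor_linear_comp[OF _ X]
      tensor_linear_raise tensor_linear_lower tensor_linear_weight
    have Tr: "T (raise (Suc n) t) = raise (Suc n) (T t)" if t: "t \<in> ?V" for t
    proof (rule tensor_linear_eqI[OF _ _ _ _ t])
      fix s assume s: "s \<subseteq> {1..n}"
      let ?v = "v_vec (Suc n) s"
      have r: "raise (Suc n) (T ?v) = 0" "T (lower (Suc n) ?v) = lower (Suc n) (T ?v)" using R s by blast+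
      show "T (raise (Suc n) ?v) = raise (Suc n) (T ?v)"
        by (simp add: r tensor_linear_0[OF X])
      have "raise (Suc n) (lower (Suc n) (T ?v)) = tscale (of_nat (Suc n)) (T ?v)"
        using raise_lower_tensor_power[OF tensor_linear_closed[OF X v_vec_closed, of s]] by (simp add: r)
      then show "T (raise (Suc n) (lower (Suc n) ?v)) = raise (Suc n) (T (lower (Suc n) ?v))"
        by (simp only: r raise_lower_v_vec tensor_linear_tscale[OF X v_vec_closed])
    qed (intro lin)+
    have Tl: "T (lower (Suc n) t) = lower (Suc n) (T t)" if t: "t \<in> ?V" for t
    proof (rule tensor_linear_eqI[OF _ _ _ _ t])
      fix s assume s: "s \<subseteq> {1..n}"
      let ?v = "v_vec (Suc n) s"
      have r: "T (lower (Suc n) ?v) = lower (Suc n) (T ?v)" using R s by blast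
      then show "T (lower (Suc n) ?v) = lower (Suc n) (T ?v)" .
      show "T (lower (Suc n) (lower (Suc n) ?v)) = lower (Suc n) (T (lower (Suc n) ?v))"
        by (simp add: r tensor_linear_0[OF X])
    qed (intro lin)+
    have Tw: "T (weight t) = weight (T t)" if t: "t \<in> ?V" for t
    proof (rule tensor_linear_eqI[OF _ _ _ _ t])
      fix s assume s: "s \<subseteq> {1..n}"
      let ?v = "v_vec (Suc n) s"
      have r: "T (lower (Suc n) ?v) = lower (Suc n) (T ?v)"
        "weight (T ?v) = tscale (of_nat (Suc (card s))) (T ?v)" using R s by blast+
      show "T (weight ?v) = weight (T ?v)"
        by (simp only: r weight_v_vec[OF s] tensor_linear_tscale[OF X v_vec_closed])
      show "T (weight (lower (Suc n) ?v)) = weight (T (lower (Suc n) ?v))"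
        by (simp only: r weight_lower_scaled[OF weight_v_vec[OF s]] weight_lower_scaled[OF r(2)]
            tensor_linear_tscale[OF X lower_closed[OF v_vec_closed]])
    qed (intro lin)+
    show ?L unfolding L
    proof (intro allI ballI)
      fix a t assume t: "t \<in> ?V"
      note cl = raise_closed lower_closed tensor_linear_closed[OF tensor_linear_weight]
        tensor_power_tscale tensor_power_add t
      show "T (gl_act (Suc n) a t) = gl_act (Suc n) a (T t)"
        unfolding gl_act_eq[OF t] gl_act_eq[OF tensor_linear_closed[OF X t]]
        by (simp only: tensor_linear_add[OF X] tensor_linear_tscale[OF X] cl Tr Tl Tw)
    qed
  qed
qed

lemma rook_action_End_gl:
  assumes a: "a \<in> carrier (planar_rook_algebra n)"
  shows "rook_action (Suc n) a \<in> carrier (End_gl_algebra (Suc n))"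
  unfolding End_gl_iff[OF rook_action_End]
proof (intro allI impI conjI)
  fix s assume s: "s \<subseteq> {1..n}"
  note sum = tensor_linear_sum[OF tensor_linear_raise, OF tensor_power_tscale[OF v_vec_closed]]
     tensor_linear_sum[OF tensor_linear_weight, OF tensor_power_tscale[OF v_vec_closed]]
  show "raise (Suc n) (rook_action (Suc n) a (v_vec (Suc n) s)) = 0"
    unfolding rook_action_v[OF a s] sum raise_linear raise_v_vec by simp
  show "rook_action (Suc n) a (lower (Suc n) (v_vec (Suc n) s)) =
      lower (Suc n) (rook_action (Suc n) a (v_vec (Suc n) s))"
    by (rule rook_action_fv[OF s])
  have "weight (rook_action (Suc n) a (v_vec (Suc n) s)) =
      (\<Sum>r\<in>Pow {1..n}. tscale (diagram_matrix n a r s) (tscale (of_nat (Suc (card r))) (v_vec (Suc n) r)))"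
    unfolding rook_action_v[OF a s] sum weight_linear by (rule sum.cong) (simp_all add: weight_v_vec)
  also have "\<dots> = tscale (of_nat (Suc (card s))) (rook_action (Suc n) a (v_vec (Suc n) s))"
  proof -
    have "diagram_matrix n a r s * of_nat (Suc (card r)) = of_nat (Suc (card s)) * diagram_matrix n a r s" for r
      using diagram_matrix_card[of n a r s] by (cases "diagram_matrix n a r s = 0") auto
    then show ?thesis
      unfolding rook_action_v[OF a s]
      by (simp only: fun_eq_iff sum_tensor_apply tscale_def sum_distrib_left mult.assoc[symmetric] simp_thms)
  qed
  finally show "weight (rook_action (Suc n) a (v_vec (Suc n) s)) =
      tscale (of_nat (Suc (card s))) (rook_action (Suc n) a (v_vec (Suc n) s))" .
qed

lemma rook_action_inj: "inj_on (rook_action (Suc n)) (carrier (planar_rook_algebra n))"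
proof (rule inj_onI)
  fix a b assume ab: "a \<in> carrier (planar_rook_algebra n)" "b \<in> carrier (planar_rook_algebra n)"
    and eq: "rook_action (Suc n) a = rook_action (Suc n) b"
  have "diagram_matrix n (a - b) r s = 0" if "r \<subseteq> {1..n}" "s \<subseteq> {1..n}" for r s
    using rook_action_coordinate[OF ab(1) that(2,1)] rook_action_coordinate[OF ab(2) that(2,1)] eq
    by (simp add: diagram_matrix_diff)
  moreover have "a - b \<in> carrier (planar_rook_algebra n)"
    using ab by (simp add: carrier_planar_rook_algebra)
  ultimately have "a - b = 0" by (intro diagram_matrix_eq_0_imp)
  then show "a = b" by simp
qed

text \<open>The matrix \<open>M\<close> of \<open>T\<close> on the kernel of \<open>e\<close> is weight preserving: comparing the two sides of the weight
  equation for \<open>T v\<^sub>s\<close> at the word of \<open>r\<close> gives \<open>(|r| + 1) M r s = (|s| + 1) M r s\<close>.  It is therefore the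
  matrix of some element of the planar rook algebra.\<close>

lemma rook_action_surj:
  assumes T: "T \<in> carrier (End_gl_algebra (Suc n))"
  shows "T \<in> rook_action (Suc n) ` carrier (planar_rook_algebra n)"
proof -
  have E: "T \<in> carrier (End_algebra (Suc n))" using T by (simp add: End_gl_algebra_def)
  then have X: "tensor_linear (Suc n) T" by (simp add: carrier_End_algebra)
  have gl: "raise (Suc n) (T (v_vec (Suc n) s)) = 0"
    "weight (T (v_vec (Suc n) s)) = tscale (of_nat (Suc (card s))) (T (v_vec (Suc n) s))"
    "T (lower (Suc n) (v_vec (Suc n) s)) = lower (Suc n) (T (v_vec (Suc n) s))" if "s \<subseteq> {1..n}" for s
    using T that unfolding End_gl_iff[OF E] by blast+
  define M where "M = (\<lambda>r s. T (v_vec (Suc n) s) (1 # subset_word n r))"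
  have Tv: "T (v_vec (Suc n) s) = (\<Sum>r\<in>Pow {1..n}. tscale (M r s) (v_vec (Suc n) r))" if s: "s \<subseteq> {1..n}" for s
    unfolding M_def by (rule raise_kernel_expansion[OF tensor_linear_closed[OF X v_vec_closed] gl(1)[OF s]])
  have card: "card r = card s" if rs: "r \<subseteq> {1..n}" "s \<subseteq> {1..n}" "M r s \<noteq> 0" for r s
  proof -
    have "of_nat (Suc (card r)) * M r s = of_nat (Suc (card s)) * M r s"
      using fun_cong[OF gl(2)[OF rs(2)], of "1 # subset_word n r"]
      by (simp add: weight_def tscale_def M_def count_subset_word[OF rs(1)])
    then have "of_nat (Suc (card r)) = (of_nat (Suc (card s)) :: complex)" using rs(3) by (simp del: of_nat_Suc)
    then show ?thesis by (simp only: of_nat_eq_iff)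
  qed
  obtain a where a: "a \<in> carrier (planar_rook_algebra n)"
    "\<And>r s. r \<subseteq> {1..n} \<Longrightarrow> s \<subseteq> {1..n} \<Longrightarrow> diagram_matrix n a r s = M r s"
    using diagram_matrix_surj[of n M] card by metis
  have v: "rook_action (Suc n) a (v_vec (Suc n) s) = T (v_vec (Suc n) s)" if s: "s \<subseteq> {1..n}" for s
    unfolding rook_action_v[OF a(1) s] Tv[OF s] by (rule sum.cong) (use a(2) s in auto)
  have "rook_action (Suc n) a = T"
    by (rule End_algebra_eqI[OF rook_action_End E v]) (simp_all only: rook_action_fv v gl(3))
  then show ?thesis using a(1) by blast
qed

theorem theorem5p2:
  fixes k :: nat
  assumes "1 \<le> k"
  shows "(\<forall>d\<in>carrier (planar_rook (k - 1)). \<exists>!T. diagram_operator k d T) \<and>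
    rook_action k \<in> algebra_hom (planar_rook_algebra (k - 1)) (End_algebra k) \<and>
    inj_on (rook_action k) (carrier (planar_rook_algebra (k - 1))) \<and>
    rook_action k ` carrier (planar_rook_algebra (k - 1)) = carrier (End_gl_algebra k)"
proof -
  obtain n where k: "k = Suc n" using assms by (cases k) auto
  have "rook_action (Suc n) ` carrier (planar_rook_algebra n) = carrier (End_gl_algebra (Suc n))"
    using rook_action_End_gl rook_action_surj by blast
  then show ?thesis
    by (simp add: k diagram_operator_iff rook_action_algebra_hom rook_action_inj)
qed

end
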